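(* In the setting of the context, let $(K^*,\tau_o^*,c^* )\in\mathcal{K}$, put $\omega_o^*=1/\tau_o^*$ and $A_{cl}^*=A_{cl}(K^*,\tau_o^*,c^* )$, and let $P^*$ be the corresponding solution of $A_{cl}^{*T}P^*+P^*A_{cl}^*=-(\tilde Q+\tilde C^{*T}R\tilde C^* )$, where $\tilde C^*=K_d^*N_d^T+K_o^*N_o^T$, $N_d=N_d(c^* )$, $K^*_d=K^*\circ\mathcal{I}_d$, $K^*_o=K^*\circ\mathcal{I}_o$. Let $\zeta_1,\zeta_2$ be chosen constants. Let $\alpha\in\mathbb{R}$, $\Delta K\in\mathbb{R}^{m\times n}$, a symmetric $\Delta P\in\mathbb{R}^{nN\times nN}$ and $\Delta\omega\in\mathbb{R}$ satisfy $$\phi_0+\phi_1+\psi_0+\alpha I\preceq0,$$ $$|\Delta\omega|\le\zeta_1,\qquad \|\Delta P\|\le\zeta_2,$$ $$\alpha\ \ge\ 2\zeta_1\|\Lambda^T\Delta P\|+2\zeta_2\|\mathcal{B}\,\Delta\tilde C\|+\|R^{1/2}\Delta\tilde C\|^2,$$ where $K=K^*+\Delta K$, $\omega_o=\omega_o^*+\Delta\omega>0$, $P=P^*+\Delta P$, $\Delta K_d=\Delta K\circ\mathcal{I}_d$, $\Delta K_o=\Delta K\circ\mathcal{I}_o$, $\Delta\tilde C=\Delta K_dN_d^T+\Delta K_oN_o^T$, $A_1=-\mathcal{B}\,\Delta\tilde C+\Delta\omega\,\Lambda$, and $$\phi_0=A_{cl}^{*T}P+PA_{cl}^*,\quad \phi_1=A_1^TP^*+P^*A_1,\quad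 \psi_0=\tilde Q+\tilde C^{*T}R\tilde C^*+\Delta\tilde C^TR\tilde C^*+\tilde C^{*T}R\,\Delta\tilde C .$$ Then $(K,1/\omega_o,c^* )$ is a stabilizing tuple, i.e. $(K,1/\omega_o,c^* )\in\mathcal{K}$.
   Context: Data: $A\in\mathbb{R}^{n\times n}$, $B\in\mathbb{R}^{n\times m}$, symmetric $Q\succeq0$ ($n\times n$), symmetric $R\succ0$ ($m\times m$), with $(A,B)$ stabilizable and $(A,Q^{1/2})$ detectable. The state coordinates are partitioned into $p$ non-overlapping groups $\bar x_1,\dots,\bar x_p$ and the input coordinates into $p$ groups $\bar u_1,\dots,\bar u_p$. $\mathcal{I}_d\in\{0,1\}^{m\times n}$ has $(i,j)$ entry $1$ iff for some $q$ the input $u_i$ belongs to $\bar u_q$ and the state $x_j$ belongs to $\bar x_q$; $\mathcal{I}_o$ is its complement (all-ones matrix minus $\mathcal{I}_d$). $\circ$ is the Hadamard (entrywise) product, $\otimes$ the Kronecker product, $\|\cdot\|$ the spectral norm. For $K\in\mathbb{R}^{m\times n}$ put $K_d=K\circ\mathcal{I}_d$, $K_o=K\circ\mathcal{I}_o$. The delays are $\tau_o>0$ and $\tau_d=c\,\tau_o$ with $c\in[0,1]$. Fix an integer $N\ge2$ and the Chebyshev extremal points $\theta_{k+1}=\frac{\tau_o}{2}\big(\cos\frac{(N-k-1)\pi}{N-1}-1\big)$, $k=0,\dots,N-1$, so $\theta_1=-\tau_o$, $\theta_N=0$. Let $l_j(\theta)=\prod_{m\ne j}\frac{\theta-\theta_m}{\theta_j-\theta_m}$,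 $j=1,\dots,N$. All $nN\times nN$ matrices are viewed as $N\times N$ block matrices with $n\times n$ blocks. $\Lambda$ is the matrix with blocks $\Lambda_{ij}=\tau_o\,l_j'(\theta_i)I_n$ for $i\le N-1$ and $\Lambda_{Nj}=0$ (it depends only on $N$ and $n$, not on $\tau_o$). $\bar A=\mathrm{Diag}(0,A)$ has the single nonzero block $A$ in position $(N,N)$. $\tilde A=\frac1{\tau_o}\Lambda+\bar A$. $M=[0,\dots,0,I_n]^T$ and $N_o=[I_n,0,\dots,0]^T$ are in $\mathbb{R}^{nN\times n}$; $\mathcal{B}=MB$; $\tilde Q=MQM^T$. $N_d(c)=[l_1(-c\tau_o),\dots,l_N(-c\tau_o)]^T\otimes I_n$, which depends only on $c$ (and $N,n$), not on $\tau_o$. $A_{cl}(K,\tau_o,c)=\tilde A-\mathcal{B}K_oN_o^T-\mathcal{B}K_dN_d(c)^T$, and $\mathcal{K}=\{(K,\tau_o,c):\ \text{all eigenvalues of }A_{cl}(K,\tau_o,c)\text{ have negative real part}\}$; its elements are called stabilizing tuples. *)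

theory Defs
  imports "HOL-Analysis.Analysis"
begin

section \<open>Real matrices\<close>

text \<open>The index orientation is that of the library: \<^typ>\<open>real ^ 'n ^ 'm\<close> has rows indexed by
  \<^typ>\<open>'m\<close> and columns indexed by \<^typ>\<open>'n\<close>. The Hadamard product is the library's componentwise
  multiplication on vectors (hence, applied twice, on matrices).\<close>

definition psd :: "real ^ 'n ^ 'n \<Rightarrow> bool" where
  "psd S \<longleftrightarrow> transpose S = S \<and> (\<forall>x. 0 \<le> x \<bullet> (S *v x))"

definition posdef :: "real ^ 'n ^ 'n \<Rightarrow> bool" where
  "posdef S \<longleftrightarrow> transpose S = S \<and> (\<forall>x. x \<noteq> 0 \<longrightarrow> 0 < x \<bullet> (S *v x))"

text \<open>\<open>msqrt S\<close> is the square root of a positive semidefinite matrix; it is meaningful only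
  for \<^prop>\<open>psd S\<close>, where the positive semidefinite root exists and is unique.\<close>

definition msqrt :: "real ^ 'n ^ 'n \<Rightarrow> real ^ 'n ^ 'n" where
  "msqrt S = (SOME T. psd T \<and> T ** T = S)"

definition spectral_norm :: "real ^ 'n ^ 'm \<Rightarrow> real" where
  "spectral_norm S = onorm (\<lambda>x. S *v x)"

definition complex_eigenvalue :: "real ^ 'n ^ 'n \<Rightarrow> complex \<Rightarrow> bool" where
  "complex_eigenvalue S z \<longleftrightarrow>
     (\<exists>v :: complex ^ 'n. v \<noteq> 0 \<and> map_matrix complex_of_real S *v v = z *s v)"

definition hurwitz :: "real ^ 'n ^ 'n \<Rightarrow> bool" where
  "hurwitz S \<longleftrightarrow> (\<forall>z. complex_eigenvalue S z \<longrightarrow> Re z < 0)"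

definition stabilizable :: "real ^ 'n ^ 'n \<Rightarrow> real ^ 'm ^ 'n \<Rightarrow> bool" where
  "stabilizable A B \<longleftrightarrow> (\<exists>F :: real ^ 'n ^ 'm. hurwitz (A - B ** F))"

definition detectable :: "real ^ 'n ^ 'n \<Rightarrow> real ^ 'n ^ 'q \<Rightarrow> bool" where
  "detectable A C \<longleftrightarrow> (\<exists>L :: real ^ 'q ^ 'n. hurwitz (A - L ** C))"

section \<open>Groups of states and inputs\<close>

definition is_grouping :: "nat \<Rightarrow> (nat \<Rightarrow> 'a set) \<Rightarrow> bool" where
  "is_grouping p G \<longleftrightarrow> disjoint_family_on G {1..p} \<and> (\<Union>q\<in>{1..p}. G q) = UNIV"

definition I_d :: "nat \<Rightarrow> (nat \<Rightarrow> 'n set) \<Rightarrow> (nat \<Rightarrow> 'm set) \<Rightarrow> real ^ 'n ^ 'm" where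
  "I_d p X U = (\<chi> i j. if \<exists>q\<in>{1..p}. i \<in> U q \<and> j \<in> X q then 1 else 0)"

definition I_o :: "nat \<Rightarrow> (nat \<Rightarrow> 'n set) \<Rightarrow> (nat \<Rightarrow> 'm set) \<Rightarrow> real ^ 'n ^ 'm" where
  "I_o p X U = (\<chi> i j. 1) - I_d p X U"

section \<open>Chebyshev collocation\<close>

text \<open>The \<open>N\<close> nodes are indexed by a finite linearly ordered type \<^typ>\<open>'k\<close> with \<open>N\<close> elements;
  the element of rank \<open>k\<close> (\<open>0 \<le> k < N\<close>) stands for the one-based index \<open>k + 1\<close>.\<close>

definition index_rank :: "'k :: {finite, linorder} \<Rightarrow> nat" where
  "index_rank i = card {j. j < i}"

definition first_index :: "'k :: {finite, linorder}" where
  "first_index = Min UNIV"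

definition last_index :: "'k :: {finite, linorder}" where
  "last_index = Max UNIV"

definition node :: "real \<Rightarrow> 'k :: {finite, linorder} \<Rightarrow> real" where
  "node \<tau> i = \<tau> / 2 *
     (cos ((real CARD('k) - real (index_rank i) - 1) * pi / (real CARD('k) - 1)) - 1)"

definition lagrange :: "real \<Rightarrow> 'k :: {finite, linorder} \<Rightarrow> real \<Rightarrow> real" where
  "lagrange \<tau> j x = (\<Prod>i\<in>UNIV - {j}. (x - node \<tau> i) / (node \<tau> j - node \<tau> i))"

section \<open>Block matrices\<close>

text \<open>The index set of \<open>\<real>\<^bsup>nN\<^esup>\<close> is \<^typ>\<open>'k \<times> 'n\<close>: the pair \<open>(i, r)\<close> is component \<open>r\<close> of block \<open>i\<close>.\<close>

definition block_mat :: "('k :: finite \<Rightarrow> 'k \<Rightarrow> real ^ 'n ^ 'n) \<Rightarrow> real ^ ('k \<times> 'n) ^ ('k \<times> 'n)" where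
  "block_mat F = (\<chi> a b. F (fst a) (fst b) $ snd a $ snd b)"

definition block_col :: "('k :: finite \<Rightarrow> real ^ 'n ^ 'n) \<Rightarrow> real ^ 'n ^ ('k \<times> 'n)" where
  "block_col F = (\<chi> a s. F (fst a) $ snd a $ s)"

text \<open>For \<open>\<tau> > 0\<close>, neither \<open>Lam \<tau>\<close> nor \<open>N_d \<tau> c\<close> actually depends on \<open>\<tau>\<close>.\<close>

definition Lam :: "real \<Rightarrow> real ^ ('k :: {finite, linorder} \<times> 'n :: finite) ^ ('k \<times> 'n)" where
  "Lam \<tau> = block_mat (\<lambda>i j. if i = last_index then 0
                             else (\<tau> * deriv (lagrange \<tau> j) (node \<tau> i)) *\<^sub>R mat 1)"

definition A_bar :: "real ^ 'n ^ 'n \<Rightarrow> real ^ ('k :: {finite, linorder} \<times> 'n) ^ ('k \<times> 'n)" where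
  "A_bar A = block_mat (\<lambda>i j. if i = last_index \<and> j = last_index then A else 0)"

definition A_tilde ::
  "real ^ 'n ^ 'n \<Rightarrow> real \<Rightarrow> real ^ ('k :: {finite, linorder} \<times> 'n) ^ ('k \<times> 'n)" where
  "A_tilde A \<tau> = (1 / \<tau>) *\<^sub>R Lam \<tau> + A_bar A"

definition M_last :: "real ^ 'n ^ ('k :: {finite, linorder} \<times> 'n)" where
  "M_last = block_col (\<lambda>i. if i = last_index then mat 1 else 0)"

definition N_o :: "real ^ 'n ^ ('k :: {finite, linorder} \<times> 'n)" where
  "N_o = block_col (\<lambda>i. if i = first_index then mat 1 else 0)"

definition N_d :: "real \<Rightarrow> real \<Rightarrow> real ^ 'n ^ ('k :: {finite, linorder} \<times> 'n)" where
  "N_d \<tau> c = block_col (\<lambda>i. lagrange \<tau> i (- c * \<tau>) *\<^sub>R mat 1)"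

definition B_cal :: "real ^ 'm ^ 'n \<Rightarrow> real ^ 'm ^ ('k :: {finite, linorder} \<times> 'n)" where
  "B_cal B = M_last ** B"

definition Q_tilde ::
  "real ^ 'n ^ 'n \<Rightarrow> real ^ ('k :: {finite, linorder} \<times> 'n) ^ ('k \<times> 'n)" where
  "Q_tilde Q = M_last ** Q ** transpose M_last"

section \<open>Closed loop\<close>

definition A_cl ::
  "real ^ 'n ^ 'n \<Rightarrow> real ^ 'm ^ 'n \<Rightarrow> nat \<Rightarrow> (nat \<Rightarrow> 'n set) \<Rightarrow> (nat \<Rightarrow> 'm set) \<Rightarrow>
   real ^ 'n ^ 'm \<Rightarrow> real \<Rightarrow> real \<Rightarrow> real ^ ('k :: {finite, linorder} \<times> 'n) ^ ('k \<times> 'n)" where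
  "A_cl A B p X U K \<tau> c =
     A_tilde A \<tau> - B_cal B ** (K * I_o p X U) ** transpose N_o
                 - B_cal B ** (K * I_d p X U) ** transpose (N_d \<tau> c)"

text \<open>The type argument supplies the number \<open>N\<close> of nodes, which the type of the tuples does
  not determine. The admissible range of the delay parameters is part of the definition.\<close>

definition stabilizing_tuples ::
  "'k :: {finite, linorder} itself \<Rightarrow> real ^ 'n ^ 'n \<Rightarrow> real ^ 'm ^ 'n \<Rightarrow>
   nat \<Rightarrow> (nat \<Rightarrow> 'n set) \<Rightarrow> (nat \<Rightarrow> 'm set) \<Rightarrow> ((real ^ 'n ^ 'm) \<times> real \<times> real) set" where
  "stabilizing_tuples _ A B p X U =
     {(K, \<tau>, c). 0 < \<tau> \<and> 0 \<le> c \<and> c \<le> 1 \<and>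
        hurwitz (A_cl A B p X U K \<tau> c :: real ^ ('k \<times> 'n) ^ ('k \<times> 'n))}"

end

theory Submission
  imports Defs "HOL-Complex_Analysis.Great_Picard"
begin

text \<open>Replacing \<open>\<Delta>K\<close>, \<open>\<Delta>\<omega>\<close>, \<open>\<Delta>P\<close> by \<open>t\<close> times themselves gives a path of closed loops from the given
  stabilizing one (\<open>t = 0\<close>) to the new one (\<open>t = 1\<close>). The Lyapunov expression along it is \<open>t L + t\<^sup>2 G\<close>, where the
  matrix inequality says \<open>L \<le> - \<alpha> I\<close> and the choice of \<open>\<alpha>\<close> says \<open>G \<le> \<alpha> I\<close>, so it is negative
  semidefinite on the whole path. Definiteness of \<open>P\<close> is not known, but on the imaginary axis the terms with \<open>P\<close>
  cancel: an eigenvector for an imaginary eigenvalue has no state or input cost, so detectability makes its last block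
  vanish, and what remains is an eigenvector of Chebyshev collocation of \<open>u' = s u\<close> with \<open>u(0) = 0\<close>, which
  has no imaginary eigenvalue. Hence no eigenvalue crosses the imaginary axis along the path.\<close>

section \<open>Collocation at the Chebyshev extremal points\<close>

text \<open>With \<open>cs\<close> fixed, the closed loop is affine in the gain and in the frequency
  1/\<tau>, though not in the delay. Moving \<open>P\<close> linearly as well gives a Lyapunov
  expression of degree two in t without constant term, since the given Lyapunov equation holds at t
  = 0. The matrix inequality contains just the terms of order zero and one; the three summands in
  the lower bound on \<open>\<alpha>\<close> dominate the quadratic ones. The resulting inequality
  is in general not strict, and the cost sees only the last block and the input, so the blocks of
  delayed state escape it. Hence a spectral fact about the collocation matrix itself is required.
  Its source is the substitution \<theta> = \<tau>/2 (cos x - 1): the nodes become equally spaced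
  angles and polynomials become cosine sums. The interior nodes yield a three-term recurrence for
  the coefficients, the node -\<tau> yields one closing equation, and the boundary value u(0) = 0
  yields the last.\<close>

text \<open>The \<open>c m\<close> are Chebyshev coefficients (with \<open>c 0\<close> and \<open>c n\<close> doubled) of a collocation solution of
  \<open>u' = s u\<close>, and \<open>h\<close> are their partial sums. For imaginary \<open>s\<close> the recurrence gives
  \<open>Re (c (k + 1) * cnj (c k)) = 4 \<bar>w\<bar>\<^sup>2\<close> for every \<open>k < n\<close>, and summation by parts gives
  \<open>(\<Sum>k = 1..n. \<bar>h k\<bar>\<^sup>2) = n \<bar>w\<bar>\<^sup>2\<close>, with the same \<open>w = h n\<close>. Since \<open>c\<close> is the difference of \<open>h\<close>, the sum
  over \<open>k\<close> of the first quantity is at most the second, so \<open>4 n \<bar>w\<bar>\<^sup>2 \<le> n \<bar>w\<bar>\<^sup>2\<close>.\<close>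

lemma imaginary_chebyshev_recurrence_trivial:
  fixes c :: "nat \<Rightarrow> complex"
  assumes n: "n \<ge> 1" and s: "Re s = 0"
    and rec: "\<And>m. 1 \<le> m \<Longrightarrow> m < n \<Longrightarrow> s * (c (m - 1) - c (m + 1)) = 2 * of_nat m * c m"
    and last: "s * (c (n - 1) - c n) = of_nat n * c n"
    and sum0: "c 0 / 2 + (\<Sum>m = 1..<n. c m) + c n / 2 = 0"
    and m: "m \<le> n"
  shows "c m = 0"
proof (cases "s = 0")
  case True
  have z: "c k = 0" if "1 \<le> k" "k \<le> n" for k
    using rec[of k] last that True n by (cases "k = n") auto
  have "(\<Sum>m = 1..<n. c m) = 0" by (rule sum.neutral) (use z in auto)
  with sum0 z[of n] n have "c 0 = 0" by simp
  with z m show ?thesis by (cases "m = 0") auto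
next
  case False
  \<comment> \<open>Subtracting \<open>c 0 / 2\<close> counts the doubled first coefficient only
    once. Then \<open>h 0 = - h 1\<close>, and the boundary condition \<open>sum0\<close> gives the
    mirror relation \<open>h (Suc n) = - h n\<close>; these make the boundary terms below
    cancel.\<close>
  define h where "h k = (\<Sum>i<k. c i) - c 0 / 2" for k
  have h_Suc: "h (Suc k) = h k + c k" for k by (simp add: h_def)
  have c_h: "c k = h (Suc k) - h k" for k by (simp add: h_Suc)
  define w where "w = h n"
  have h_n: "h n = - c n / 2"
  proof -
    have "(\<Sum>i<n. c i) = c 0 + (\<Sum>m = 1..<n. c m)"
      using n sum.atLeast_Suc_lessThan[of 0 n c] by (simp add: atLeast0LessThan)
    moreover have "(\<Sum>m = 1..<n. c m) = - c 0 / 2 - c n / 2"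
    proof -
      have "(\<Sum>m = 1..<n. c m) = (c 0 / 2 + (\<Sum>m = 1..<n. c m) + c n / 2) - c 0 / 2 - c n / 2" by simp
      then show ?thesis by (simp only: sum0) simp
    qed
    ultimately show ?thesis by (simp add: h_def)
  qed
  then have h_n1: "h (Suc n) = - w" and c_n: "c n = - 2 * w"
    by (simp_all add: h_Suc w_def)
  have h0: "h 0 = - h 1" by (simp add: h_def)
  \<comment> \<open>\<open>R\<close> sums the right-hand sides \<open>m * c m\<close> of the
    recurrence by parts. The recurrence is a difference of consecutive relations \<open>eR\<close>,
    so it integrates downwards from \<open>last\<close> to a first-order relation.\<close>
  define R where "R k = of_nat k * h (Suc k) + (\<Sum>m = Suc k..n. h m)" for k
  have R_step: "R k - R (Suc k) = - of_nat (Suc k) * c (Suc k)" if "k < n" for k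
  proof -
    have "(\<Sum>m = Suc k..n. h m) = h (Suc k) + (\<Sum>m = Suc (Suc k)..n. h m)"
      using that by (simp add: sum.atLeast_Suc_atMost)
    then show ?thesis by (simp add: R_def c_h algebra_simps)
  qed
  have eR: "s * (c k + c (Suc k)) = - 4 * s * w - 2 * R k" if "k < n" for k
    using that
  proof (induction "n - k" arbitrary: k)
    case (Suc d)
    show ?case
    proof (cases "Suc k = n")
      case True
      then have "R k = of_nat n * w" by (simp add: R_def w_def flip: True) (simp add: algebra_simps)
      moreover from True have "s * c k = (s + of_nat n) * c n" using last by (auto simp: algebra_simps)
      ultimately show ?thesis using True by (simp add: c_n algebra_simps)
    next
      case False
      with Suc have k: "Suc k < n" by simp
      have "s * (c (Suc k) + c (Suc (Suc k))) = - 4 * s * w - 2 * R (Suc k)"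
        using Suc k by auto
      moreover have "s * (c k - c (Suc (Suc k))) = 2 * of_nat (Suc k) * c (Suc k)"
        using rec[of "Suc k"] k by simp
      moreover have "R k - R (Suc k) = - of_nat (Suc k) * c (Suc k)" using R_step[of k] k by simp
      ultimately show ?thesis by algebra
    qed
  qed simp
  define e where "e k = c k + c (Suc k)" for k
  \<comment> \<open>Summation by parts: \<open>e\<close> is the difference of
    \<open>h (Suc k) + h k\<close>, and \<open>R\<close> drops by a multiple of
    \<open>h (Suc (Suc k)) - h (Suc k)\<close>, so each product of the two is a difference of
    squared norms.\<close>
  have abel: "(\<Sum>k<j. e k \<bullet> R k) =
      (h (Suc j) + h j) \<bullet> R j - real j * (norm (h (Suc j)))\<^sup>2 + (\<Sum>k<j. (norm (h (Suc k)))\<^sup>2)"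
    if "j \<le> n" for j
    using that
  proof (induction j)
    case 0
    then show ?case by (simp add: h0)
  next
    case (Suc j)
    have e: "e j = (h (Suc (Suc j)) + h (Suc j)) - (h (Suc j) + h j)" by (simp add: e_def c_h)
    have "R j = R (Suc j) - real (Suc j) *\<^sub>R (h (Suc (Suc j)) - h (Suc j))"
      using R_step[of j] Suc.prems by (simp add: c_h[of "Suc j"] scaleR_conv_of_real algebra_simps)
    moreover have "(h (Suc (Suc j)) + h (Suc j)) \<bullet> (h (Suc (Suc j)) - h (Suc j))
        = (norm (h (Suc (Suc j))))\<^sup>2 - (norm (h (Suc j)))\<^sup>2"
      by (simp add: power2_norm_eq_inner algebra_simps inner_commute)
    ultimately have "(h (Suc (Suc j)) + h (Suc j)) \<bullet> R j = (h (Suc (Suc j)) + h (Suc j)) \<bullet> R (Suc j)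
        - real (Suc j) * ((norm (h (Suc (Suc j))))\<^sup>2 - (norm (h (Suc j)))\<^sup>2)"
      by (simp add: inner_diff_right)
    then show ?case using Suc
      by (simp add: e inner_diff_left inner_add_left algebra_simps)
  qed
  \<comment> \<open>Multiplication by an imaginary number is a right-angle rotation up to scale.
    Every orthogonality below comes from this: \<open>R k\<close> is orthogonal to
    \<open>e k + 4 * w\<close>, and \<open>c (Suc k)\<close> to
    \<open>c k - c (Suc (Suc k))\<close>.\<close>
  have imag: "x \<bullet> (s * x) = 0" for x
    using s by (simp add: inner_complex_def algebra_simps)
  have sum_R: "(\<Sum>k<n. R k) = (- 2 * real n) *\<^sub>R (s * w)"
  proof -
    have "(\<Sum>k<n. e k) = (\<Sum>k<n. (h (Suc (Suc k)) + h (Suc k)) - (h (Suc k) + h k))"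
      by (simp add: e_def c_h)
    also have "\<dots> = (h (Suc n) + h n) - (h (Suc 0) + h 0)"
      using sum_lessThan_telescope[of "\<lambda>k. h (Suc k) + h k" n] by simp
    also have "\<dots> = 0" using h0 h_n1 by (simp add: w_def)
    finally have "0 = (\<Sum>k<n. s * e k)" by (simp flip: sum_distrib_left)
    also have "\<dots> = (\<Sum>k<n. - 4 * s * w - 2 * R k)"
      by (rule sum.cong) (use eR in \<open>auto simp: e_def\<close>)
    also have "\<dots> = - 4 * of_nat n * s * w - 2 * (\<Sum>k<n. R k)"
      by (simp add: sum_subtractf sum_distrib_left)
    finally show ?thesis by (simp add: scaleR_conv_of_real algebra_simps)
  qed
  have norm_sum: "(\<Sum>k<n. (norm (h (Suc k)))\<^sup>2) = real n * (norm w)\<^sup>2"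
  proof -
    have "e k \<bullet> R k = - 4 * (w \<bullet> R k)" if "k < n" for k
    proof -
      have "2 * R k = - 4 * s * w - s * e k" unfolding e_def eR[OF that] by simp
      also have "\<dots> = - (s * (e k + 4 * w))" by (simp add: algebra_simps)
      finally have "2 *\<^sub>R R k = - (s * (e k + 4 * w))" unfolding scaleR_conv_of_real by simp
      then have "(e k + 4 * w) \<bullet> (2 *\<^sub>R R k) = 0"
        using imag[of "e k + 4 * w"] by (simp only: inner_minus_right minus_zero)
      then have "(e k + 4 * w) \<bullet> R k = 0" by simp
      then show ?thesis by (simp add: inner_complex_def algebra_simps)
    qed
    then have "(\<Sum>k<n. e k \<bullet> R k) = - 4 * (w \<bullet> (\<Sum>k<n. R k))"
      by (simp add: sum_distrib_left inner_sum_right)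
    also have "\<dots> = 0" by (simp add: sum_R imag)
    finally show ?thesis using abel[of n] h_n1 by (simp add: w_def)
  qed
  have const: "c (Suc k) \<bullet> c k = 4 * (norm w)\<^sup>2" if "k < n" for k
    using that
  proof (induction "n - k" arbitrary: k)
    case (Suc d)
    show ?case
    proof (cases "Suc k = n")
      case True
      have "(c k - c n) \<bullet> c n = 0"
      proof -
        have "real n *\<^sub>R c n = s * (c k - c n)" using last True
          by (auto simp: scaleR_conv_of_real)
        then have "(c k - c n) \<bullet> (real n *\<^sub>R c n) = 0" by (simp only: imag)
        then show ?thesis using n by simp
      qed
      then show ?thesis using True
        by (auto simp: inner_diff_left c_n power2_norm_eq_inner inner_commute inner_complex_def algebra_simps)
    next
      case False
      with Suc have k: "Suc k < n" by simp
      have "(c k - c (Suc (Suc k))) \<bullet> c (Suc k) = 0"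
      proof -
        have "(2 * real (Suc k)) *\<^sub>R c (Suc k) = s * (c k - c (Suc (Suc k)))"
          using rec[of "Suc k"] k by (simp add: scaleR_conv_of_real)
        then have "(c k - c (Suc (Suc k))) \<bullet> ((2 * real (Suc k)) *\<^sub>R c (Suc k)) = 0" by (simp only: imag)
        then show ?thesis by simp
      qed
      moreover have "c (Suc (Suc k)) \<bullet> c (Suc k) = 4 * (norm w)\<^sup>2" using Suc k by auto
      ultimately show ?thesis by (simp add: inner_diff_left inner_diff_right inner_commute)
    qed
  qed simp
  have "4 * (norm w)\<^sup>2 \<le> ((norm (h (Suc (Suc k))))\<^sup>2 + (norm (h k))\<^sup>2) / 2" if "k < n" for k
  proof -
    have "4 * (c (Suc k) \<bullet> c k) \<le> (norm (c (Suc k) + c k))\<^sup>2"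
      using zero_le_power2[of "norm (c (Suc k) - c k)"]
      unfolding power2_norm_eq_inner by (simp add: algebra_simps inner_commute)
    also have "c (Suc k) + c k = h (Suc (Suc k)) - h k" by (simp add: c_h)
    also have "(norm \<dots>)\<^sup>2 \<le> 2 * ((norm (h (Suc (Suc k))))\<^sup>2 + (norm (h k))\<^sup>2)"
      using zero_le_power2[of "norm (h (Suc (Suc k)) + h k)"]
      unfolding power2_norm_eq_inner by (simp add: algebra_simps inner_commute)
    finally show ?thesis using const[OF that] by simp
  qed
  then have "(\<Sum>k<n. 4 * (norm w)\<^sup>2) \<le> (\<Sum>k<n. ((norm (h (Suc (Suc k))))\<^sup>2 + (norm (h k))\<^sup>2) / 2)"
    by (intro sum_mono) auto
  also have "\<dots> = ((\<Sum>k<n. (norm (h (Suc (Suc k))))\<^sup>2) + (\<Sum>k<n. (norm (h k))\<^sup>2)) / 2"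
    by (simp add: sum.distrib sum_divide_distrib add_divide_distrib)
  \<comment> \<open>Both shifted sums are compared with the one in \<open>norm_sum\<close>; the
    boundary terms cancel because \<open>h 0 = - h 1\<close> and
    \<open>h (Suc n) = - h n\<close>.\<close>
  also have "(\<Sum>k<n. (norm (h (Suc (Suc k))))\<^sup>2) = (\<Sum>k<n. (norm (h (Suc k)))\<^sup>2) - (norm (h (Suc 0)))\<^sup>2 + (norm (h (Suc n)))\<^sup>2"
    using sum_lessThan_telescope[of "\<lambda>k. (norm (h (Suc k)))\<^sup>2" n] by (simp add: sum_subtractf)
  also have "(\<Sum>k<n. (norm (h k))\<^sup>2) = (\<Sum>k<n. (norm (h (Suc k)))\<^sup>2) - (norm (h n))\<^sup>2 + (norm (h 0))\<^sup>2"
    using sum_lessThan_telescope[of "\<lambda>k. (norm (h k))\<^sup>2" n] by (simp add: sum_subtractf)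
  finally have "4 * (real n * (norm w)\<^sup>2) \<le> real n * (norm w)\<^sup>2"
    using h0 h_n1 by (simp add: norm_sum w_def)
  then have "real n * (norm w)\<^sup>2 \<le> 0" by linarith
  with n have "norm w = 0"
    by (metis less_le_trans mult_le_0_iff norm_eq_zero not_le of_nat_0_less_iff power2_less_eq_zero_iff zero_less_one)
  with norm_sum have "(\<Sum>k<n. (norm (h (Suc k)))\<^sup>2) = 0" by simp
  then have hz: "h (Suc k) = 0" if "k < n" for k using that by (simp add: sum_nonneg_eq_0_iff)
  have "h k = 0" if "k \<le> Suc n" for k
    using that hz[of "k - 1"] h0 hz[of 0] n h_n1 \<open>norm w = 0\<close>
    by (cases "k = 0"; cases "k = Suc n") auto
  with m show ?thesis by (simp add: c_h)
qed

text \<open>On the unit circle a sine sum is, up to a unimodular factor, a polynomial of degree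
  below 2n. Odd symmetry extends its zeros from the interior angles to all 2n-th roots of unity,
  which is one zero too many.\<close>

lemma discrete_sine_independent:
  fixes b :: "nat \<Rightarrow> complex"
  assumes zero: "\<And>l. 1 \<le> l \<Longrightarrow> l < n \<Longrightarrow> (\<Sum>m = 1..<n. b m * of_real (sin (real m * (real l * pi / real n)))) = 0"
    and m: "1 \<le> m" "m < n"
  shows "b m = 0"
proof (rule ccontr)
  assume nz: "b m \<noteq> 0"
  \<comment> \<open>These are the coefficients of z^n times the sum of \<open>b m\<close> (z^m -
    z^(-m)); the factor z^n clears the negative powers.\<close>
  define C where "C k = (if k < n then if k = 0 then 0 else - b (n - k) else if k = n then 0 else b (k - n))" for k
  define \<phi> where "\<phi> l = real l * pi / real n" for l
  have n: "n > 0" using m by simp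
  have sin_zero: "(\<Sum>m = 1..<n. b m * of_real (sin (real m * \<phi> l))) = 0" if "l < 2 * n" for l
  proof -
    consider "l = 0" | "1 \<le> l" "l < n" | "l = n" | "n < l" using that by linarith
    then show ?thesis
    proof cases
      case 1
      then show ?thesis by (simp add: \<phi>_def)
    next
      case 2
      with zero show ?thesis by (simp add: \<phi>_def)
    next
      case 3
      then show ?thesis using n by (simp add: \<phi>_def)
    next
      case 4
      have "sin (real k * \<phi> l) = - sin (real k * \<phi> (2 * n - l))" for k
      proof -
        have "real k * \<phi> l = 2 * real k * pi - real k * \<phi> (2 * n - l)"
          using that n by (simp add: \<phi>_def of_nat_diff field_simps)
        also have "sin \<dots> = - sin (real k * \<phi> (2 * n - l))"
          using sin_2npi[of k] cos_2npi[of k] by (simp add: sin_diff)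
        finally show ?thesis .
      qed
      then show ?thesis using zero[of "2 * n - l"] 4 that
        by (simp add: \<phi>_def sum_negf)
    qed
  qed
  have "(\<Sum>k\<le>2 * n - 1. C k * cis (\<phi> l) ^ k) = 0" if "l < 2 * n" for l
  proof -
    have "(\<Sum>k\<le>2 * n - 1. C k * cis (\<phi> l) ^ k) = (\<Sum>k<2 * n. C k * cis (\<phi> l) ^ k)"
      using n by (intro sum.cong) auto
    also have "\<dots> = (\<Sum>k<n. C k * cis (\<phi> l) ^ k) + (\<Sum>k = n..<2 * n. C k * cis (\<phi> l) ^ k)"
      by (subst sum.union_disjoint[symmetric]) (auto intro!: sum.cong)
    also have "(\<Sum>k<n. C k * cis (\<phi> l) ^ k) = (\<Sum>k = 1..<n. C k * cis (\<phi> l) ^ k)"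
      by (rule sum.mono_neutral_right) (auto simp: C_def)
    also have "\<dots> = (\<Sum>k = 1..<n. - b k * cis (\<phi> l) ^ (n - k))"
      by (rule sum.reindex_bij_witness[of _ "\<lambda>k. n - k" "\<lambda>k. n - k"]) (auto simp: C_def)
    also have "(\<Sum>k = n..<2 * n. C k * cis (\<phi> l) ^ k) = (\<Sum>k = n + 1..<2 * n. C k * cis (\<phi> l) ^ k)"
      by (rule sum.mono_neutral_right) (auto simp: C_def)
    also have "\<dots> = (\<Sum>k = 1..<n. b k * cis (\<phi> l) ^ (n + k))"
      by (rule sum.reindex_bij_witness[of _ "\<lambda>k. n + k" "\<lambda>k. k - n"]) (auto simp: C_def)
    also have "(\<Sum>k = 1..<n. - b k * cis (\<phi> l) ^ (n - k)) + (\<Sum>k = 1..<n. b k * cis (\<phi> l) ^ (n + k))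
        = (\<Sum>k = 1..<n. 2 * \<i> * cis (real n * \<phi> l) * (b k * of_real (sin (real k * \<phi> l))))"
      unfolding sum.distrib[symmetric]
    proof (rule sum.cong)
      fix k assume "k \<in> {1..<n}"
      then have angles: "real (n - k) * \<phi> l = real n * \<phi> l + - (real k * \<phi> l)"
        "real (n + k) * \<phi> l = real n * \<phi> l + real k * \<phi> l"
        by (simp_all add: of_nat_diff algebra_simps)
      have pow: "cis (\<phi> l) ^ (n - k) = cis (real n * \<phi> l) * cis (- (real k * \<phi> l))"
        "cis (\<phi> l) ^ (n + k) = cis (real n * \<phi> l) * cis (real k * \<phi> l)"
        by (simp_all only: Complex.DeMoivre cis_mult angles)
      have "- b k * (e * x) + b k * (e * y) = e * (b k * (y - x))" for e x y
        by (simp add: algebra_simps)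
      then have "- b k * cis (\<phi> l) ^ (n - k) + b k * cis (\<phi> l) ^ (n + k)
          = cis (real n * \<phi> l) * (b k * (cis (real k * \<phi> l) - cis (- (real k * \<phi> l))))"
        unfolding pow .
      also have "cis (real k * \<phi> l) - cis (- (real k * \<phi> l)) = 2 * \<i> * of_real (sin (real k * \<phi> l))"
        by (simp add: complex_eq_iff)
      finally show "- b k * cis (\<phi> l) ^ (n - k) + b k * cis (\<phi> l) ^ (n + k)
          = 2 * \<i> * cis (real n * \<phi> l) * (b k * of_real (sin (real k * \<phi> l)))"
        by (simp only: mult_ac)
    qed simp
    also have "\<dots> = 2 * \<i> * cis (real n * \<phi> l) * (\<Sum>k = 1..<n. b k * of_real (sin (real k * \<phi> l)))"
      by (simp only: sum_distrib_left)
    finally show ?thesis using sin_zero[OF that] by simp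
  qed
  then have sub: "(\<lambda>l. cis (\<phi> l)) ` {..<2 * n} \<subseteq> {z. (\<Sum>k\<le>2 * n - 1. C k * z ^ k) = 0}" by auto
  have "inj_on (\<lambda>l. cis (\<phi> l)) {..<2 * n}"
    using bij_betw_imp_inj_on[OF Complex.bij_betw_roots_unity[of "2 * n"]] n by (simp add: \<phi>_def mult_ac)
  then have card: "card ((\<lambda>l. cis (\<phi> l)) ` {..<2 * n}) = 2 * n" by (simp add: card_image)
  have "C (n + m) \<noteq> 0" "n + m \<le> 2 * n - 1" using nz m by (auto simp: C_def)
  then have "finite {z. (\<Sum>k\<le>2 * n - 1. C k * z ^ k) = 0}" "card {z. (\<Sum>k\<le>2 * n - 1. C k * z ^ k) = 0} \<le> 2 * n - 1"
    using Transcendental.polyfun_rootbound[of C "n + m" "2 * n - 1"] by auto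
  from card_mono[OF this(1) sub] this(2) have "2 * n \<le> 2 * n - 1" unfolding card by linarith
  with n show False by simp
qed

text \<open>The form taken by polynomials of degree at most n in cos x. It supplies Chebyshev
  coefficients without introducing Chebyshev polynomials.\<close>

definition cos_sum :: "nat \<Rightarrow> (real \<Rightarrow> real) \<Rightarrow> bool" where
  "cos_sum n f \<longleftrightarrow> (\<exists>a. \<forall>x. f x = (\<Sum>m\<le>n. a m * cos (real m * x)))"

lemma cos_sum_add: "cos_sum n f \<Longrightarrow> cos_sum n g \<Longrightarrow> cos_sum n (\<lambda>x. f x + g x)"
  unfolding cos_sum_def
proof (elim exE)
  fix a b
  assume "\<forall>x. f x = (\<Sum>m\<le>n. a m * cos (real m * x))" "\<forall>x. g x = (\<Sum>m\<le>n. b m * cos (real m * x))"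
  then show "\<exists>a. \<forall>x. f x + g x = (\<Sum>m\<le>n. a m * cos (real m * x))"
    by (intro exI[of _ "\<lambda>m. a m + b m"]) (simp add: sum.distrib distrib_right)
qed

lemma cos_sum_scale: "cos_sum n f \<Longrightarrow> cos_sum n (\<lambda>x. r * f x)"
  unfolding cos_sum_def
proof (elim exE)
  fix a
  assume "\<forall>x. f x = (\<Sum>m\<le>n. a m * cos (real m * x))"
  then show "\<exists>a. \<forall>x. r * f x = (\<Sum>m\<le>n. a m * cos (real m * x))"
    by (intro exI[of _ "\<lambda>m. r * a m"]) (simp add: sum_distrib_left mult.assoc)
qed

lemma cos_sum_cos: "m \<le> n \<Longrightarrow> cos_sum n (\<lambda>x. cos (real m * x))"
  unfolding cos_sum_def
  by (intro exI[of _ "\<lambda>k. if k = m then 1 else 0"]) (simp add: if_distrib[of "\<lambda>r. r * _"] cong: if_cong)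

lemma cos_sum_sum: "finite S \<Longrightarrow> (\<And>i. i \<in> S \<Longrightarrow> cos_sum n (f i)) \<Longrightarrow> cos_sum n (\<lambda>x. \<Sum>i\<in>S. f i x)"
proof (induction S rule: finite_induct)
  case empty
  show ?case using cos_sum_scale[OF cos_sum_cos[of 0 n], of 0] by simp
next
  case (insert i S)
  then show ?case by (simp add: cos_sum_add)
qed

text \<open>The product formula for two cosines raises the largest frequency by one. Each linear
  factor of a Lagrange polynomial becomes affine in cos x, so these factors can be multiplied in one
  at a time.\<close>

lemma cos_sum_mult_affine_cos:
  assumes "cos_sum n f"
  shows "cos_sum (Suc n) (\<lambda>x. (p * cos x + q) * f x)"
proof -
  from assms obtain a where a: "\<And>x. f x = (\<Sum>m\<le>n. a m * cos (real m * x))"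
    unfolding cos_sum_def by blast
  have cos_cos: "cos_sum (Suc n) (\<lambda>x. cos x * cos (real m * x))" if "m \<le> n" for m
  proof (cases m)
    case 0
    then show ?thesis using cos_sum_cos[of 1 "Suc n"] by simp
  next
    case (Suc k)
    have "cos x * cos (real m * x) = (1 / 2) * cos (real (Suc m) * x) + (1 / 2) * cos (real k * x)" for x
      using cos_times_cos[of "real m * x" x] Suc by (simp add: algebra_simps)
    moreover have "cos_sum (Suc n) (\<lambda>x. (1 / 2) * cos (real (Suc m) * x) + (1 / 2) * cos (real k * x))"
      by (intro cos_sum_add cos_sum_scale cos_sum_cos) (use that Suc in auto)
    ultimately show ?thesis by simp
  qed
  have "cos_sum (Suc n) (\<lambda>x. \<Sum>m\<le>n. a m * p * (cos x * cos (real m * x)) + a m * q * cos (real m * x))"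
    by (intro cos_sum_sum cos_sum_add cos_sum_scale cos_cos cos_sum_cos) auto
  also have "(\<lambda>x. \<Sum>m\<le>n. a m * p * (cos x * cos (real m * x)) + a m * q * cos (real m * x))
      = (\<lambda>x. (p * cos x + q) * f x)"
    by (simp add: a sum_distrib_left fun_eq_iff algebra_simps sum.distrib)
  finally show ?thesis .
qed

lemma cos_sum_prod_affine_cos:
  "finite S \<Longrightarrow> cos_sum (card S) (\<lambda>x. \<Prod>i\<in>S. p i * cos x + q i)"
proof (induction S rule: finite_induct)
  case empty
  show ?case using cos_sum_cos[of 0 0] by simp
next
  case (insert i S)
  then show ?case using cos_sum_mult_affine_cos[OF insert.IH] by simp
qed

section \<open>Chebyshev nodes and their Lagrange basis\<close>

lemma index_rank_strict_mono: "strict_mono (index_rank :: 'k :: {finite, linorder} \<Rightarrow> nat)"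
proof (rule strict_monoI)
  fix i j :: 'k assume "i < j"
  then show "index_rank i < index_rank j" unfolding index_rank_def by (intro psubset_card_mono) auto
qed

lemma index_rank_less: "index_rank (i :: 'k :: {finite, linorder}) < CARD('k)"
  unfolding index_rank_def by (intro psubset_card_mono) auto

lemma index_rank_image: "range (index_rank :: 'k :: {finite, linorder} \<Rightarrow> nat) = {..<CARD('k)}"
proof (rule card_subset_eq)
  show "card (range (index_rank :: 'k \<Rightarrow> nat)) = card {..<CARD('k)}"
    by (simp only: card_image[OF strict_mono_imp_inj_on[OF index_rank_strict_mono]] card_lessThan)
qed (use index_rank_less in auto)

lemma index_rank_last: "index_rank (last_index :: 'k :: {finite, linorder}) = CARD('k) - 1"
proof -
  have "{j :: 'k. j < last_index} = UNIV - {last_index}"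
    unfolding last_index_def using Max_ge[of "UNIV :: 'k set"] by (auto simp: less_le)
  then show ?thesis by (simp add: index_rank_def)
qed

lemma node_eq:
  fixes i :: "'k :: {finite, linorder}"
  shows "node \<tau> i = \<tau> / 2 * (cos (real (CARD('k) - 1 - index_rank i) * pi / real (CARD('k) - 1)) - 1)"
proof -
  have "real (CARD('k) - 1 - index_rank i) = real CARD('k) - real (index_rank i) - 1"
    "real (CARD('k) - 1) = real CARD('k) - 1"
    using index_rank_less[of i] by linarith+
  then show ?thesis by (simp only: node_def)
qed

lemma inj_node:
  assumes "CARD('k :: {finite, linorder}) \<ge> 2" "\<tau> > 0"
  shows "inj (node \<tau> :: 'k \<Rightarrow> real)"
proof (rule injI)
  fix i j :: 'k
  let ?n = "CARD('k) - 1"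
  define l where "l i = ?n - index_rank i" for i :: 'k
  assume "node \<tau> i = node \<tau> j"
  then have eq: "cos (real (l i) * pi / real ?n) = cos (real (l j) * pi / real ?n)"
    using assms(2) unfolding node_eq l_def by simp
  have range: "0 \<le> real (l i) * pi / real ?n" "real (l i) * pi / real ?n \<le> pi" for i
  proof -
    have "real (l i) * pi \<le> real ?n * pi"
      by (intro mult_right_mono) (simp_all add: l_def of_nat_le_iff del: of_nat_diff)
    then show "0 \<le> real (l i) * pi / real ?n" "real (l i) * pi / real ?n \<le> pi"
      using assms(1) by (simp_all add: pos_divide_le_eq mult.commute del: of_nat_diff)
  qed
  have "real (l i) * pi / real ?n = real (l j) * pi / real ?n"
    by (rule cos_inj_pi[OF range range eq])
  then have "l i = l j" using assms(1) by simp
  then have "index_rank i = index_rank j"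
    using index_rank_less[of i] index_rank_less[of j] by (simp add: l_def)
  then show "i = j" using strict_mono_imp_inj_on[OF index_rank_strict_mono] by (auto dest: injD)
qed

lemma lagrange_node:
  fixes i j :: "'k :: {finite, linorder}"
  assumes "CARD('k) \<ge> 2" "\<tau> > 0"
  shows "lagrange \<tau> j (node \<tau> i) = (if i = j then 1 else 0)"
proof (cases "i = j")
  case True
  then show ?thesis using inj_node[OF assms] unfolding lagrange_def
    by (auto intro!: prod.neutral simp: inj_eq)
next
  case False
  then show ?thesis unfolding lagrange_def by (auto intro!: prod_zero bexI[of _ i])
qed

definition lagrange_poly :: "real \<Rightarrow> 'k :: {finite, linorder} \<Rightarrow> real poly" where
  "lagrange_poly \<tau> j = (\<Prod>i\<in>UNIV - {j}. smult (1 / (node \<tau> j - node \<tau> i)) [:- node \<tau> i, 1:])"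

lemma lagrange_eq_poly: "lagrange \<tau> j = poly (lagrange_poly \<tau> j)"
  by (simp add: fun_eq_iff lagrange_def lagrange_poly_def poly_prod algebra_simps diff_divide_distrib)

lemma lagrange_field_differentiable: "lagrange \<tau> j field_differentiable at x"
  unfolding lagrange_eq_poly field_differentiable_def using poly_DERIV by blast

lemma deriv_lagrange: "deriv (lagrange \<tau> j) = poly (pderiv (lagrange_poly \<tau> j))"
  unfolding lagrange_eq_poly by (auto simp: fun_eq_iff intro: DERIV_imp_deriv poly_DERIV)

text \<open>The second formula is the derivative of the first in x. At the node -\<tau>, where x =
  pi, it degenerates to 0 = 0, so the derivative there has to be read off from a further
  differentiation.\<close>

lemma lagrange_cos_expansion:
  fixes j :: "'k :: {finite, linorder}"
  obtains a where
    "\<And>x. lagrange \<tau> j (\<tau> / 2 * (cos x - 1)) = (\<Sum>m\<le>CARD('k) - 1. a m * cos (real m * x))"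
    "\<And>x. \<tau> / 2 * deriv (lagrange \<tau> j) (\<tau> / 2 * (cos x - 1)) * sin x = (\<Sum>m\<le>CARD('k) - 1. real m * a m * sin (real m * x))"
    "\<tau> / 2 * deriv (lagrange \<tau> j) (- \<tau>) = - (\<Sum>m\<le>CARD('k) - 1. (real m)\<^sup>2 * a m * (- 1) ^ m)"
proof -
  let ?n = "CARD('k) - 1"
  define \<theta> where "\<theta> x = \<tau> / 2 * (cos x - 1)" for x
  have d\<theta>: "(\<theta> has_real_derivative - (\<tau> / 2 * sin x)) (at x)" for x
    unfolding \<theta>_def by (auto intro!: derivative_eq_intros)
  define L where "L = lagrange_poly \<tau> j"
  have "lagrange \<tau> j (\<theta> x) = (\<Prod>i\<in>UNIV - {j}. (\<tau> / 2 / (node \<tau> j - node \<tau> i)) * cos x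
      + (- \<tau> / 2 - node \<tau> i) / (node \<tau> j - node \<tau> i))" for x
    unfolding lagrange_def \<theta>_def by (intro prod.cong) (auto simp: algebra_simps diff_divide_distrib add_divide_distrib)
  then have "cos_sum (card (UNIV - {j})) (\<lambda>x. lagrange \<tau> j (\<theta> x))"
    by (simp only: cos_sum_prod_affine_cos[OF finite])
  then obtain a where a: "\<And>x. poly L (\<theta> x) = (\<Sum>m\<le>?n. a m * cos (real m * x))"
    unfolding cos_sum_def by (auto simp: lagrange_eq_poly L_def card_Diff_singleton)
  have d1: "\<tau> / 2 * poly (pderiv L) (\<theta> x) * sin x = (\<Sum>m\<le>?n. real m * a m * sin (real m * x))" for x
  proof -
    have "((\<lambda>x. poly L (\<theta> x)) has_real_derivative poly (pderiv L) (\<theta> x) * - (\<tau> / 2 * sin x)) (at x)"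
      by (rule DERIV_chain2[OF poly_DERIV d\<theta>])
    moreover have "((\<lambda>x. poly L (\<theta> x)) has_real_derivative (\<Sum>m\<le>?n. - (real m * a m * sin (real m * x)))) (at x)"
      unfolding a by (rule DERIV_sum) (auto intro!: derivative_eq_intros)
    ultimately have "poly (pderiv L) (\<theta> x) * - (\<tau> / 2 * sin x) = (\<Sum>m\<le>?n. - (real m * a m * sin (real m * x)))"
      by (rule DERIV_unique)
    then show ?thesis by (simp add: sum_negf mult_ac)
  qed
  \<comment> \<open>Differentiating \<open>d1\<close> at pi: the term with the second derivative of
    \<open>L\<close> carries the factor sin pi = 0, and cos pi = -1 gives the sign of the third
    formula.\<close>
  have "((\<lambda>x. \<tau> / 2 * poly (pderiv L) (\<theta> x) * sin x) has_real_derivative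
      (\<tau> / 2 * (poly (pderiv (pderiv L)) (\<theta> pi) * - (\<tau> / 2 * sin pi))) * sin pi
        + \<tau> / 2 * poly (pderiv L) (\<theta> pi) * cos pi) (at pi)"
    by (rule derivative_eq_intros DERIV_chain2[OF poly_DERIV d\<theta>] refl | simp)+
  moreover have "((\<lambda>x. \<tau> / 2 * poly (pderiv L) (\<theta> x) * sin x) has_real_derivative
      (\<Sum>m\<le>?n. (real m)\<^sup>2 * a m * cos (real m * pi))) (at pi)"
    unfolding d1 by (rule DERIV_sum) (auto intro!: derivative_eq_intros simp: power2_eq_square)
  ultimately have "(\<tau> / 2 * (poly (pderiv (pderiv L)) (\<theta> pi) * - (\<tau> / 2 * sin pi))) * sin pi
        + \<tau> / 2 * poly (pderiv L) (\<theta> pi) * cos pi = (\<Sum>m\<le>?n. (real m)\<^sup>2 * a m * cos (real m * pi))"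
    by (rule DERIV_unique)
  then have "\<tau> / 2 * poly (pderiv L) (- \<tau>) = - (\<Sum>m\<le>?n. (real m)\<^sup>2 * a m * (- 1) ^ m)"
    by (simp add: \<theta>_def)
  then show thesis
    using a d1 unfolding L_def \<theta>_def deriv_lagrange[symmetric] lagrange_eq_poly[symmetric] by (rule that[rotated 2])
qed

text \<open>Summation by parts against m (-1)^m. It turns the squares of m in the derivative at
  -\<tau> into an alternating sum of the kind that gives the value at -\<tau>, plus boundary
  terms.\<close>

lemma alternating_weighted_sum:
  fixes c :: "nat \<Rightarrow> complex"
  assumes "n \<ge> 1"
  shows "(\<Sum>m = 1..<n. of_nat m * (- 1) ^ m * (c (m - 1) - c (m + 1)))
      = - c 0 - 2 * (\<Sum>m = 1..<n. (- 1) ^ m * c m) - of_nat n * (- 1) ^ n * c (n - 1)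
        + of_nat (n - 1) * (- 1) ^ n * c n"
  using assms
proof (induction n rule: nat_induct_at_least)
  case (Suc n)
  then show ?case by (simp add: of_nat_diff algebra_simps)
qed simp

text \<open>The \<open>u i\<close> are nodal values of a polynomial that solves \<tau> u' = s u at
  all nodes except the boundary node 0, where it vanishes. Its cosine coefficients satisfy the
  recurrence that has only the trivial solution for imaginary s.\<close>

lemma chebyshev_collocation_kernel:
  fixes u :: "'k :: {finite, linorder} \<Rightarrow> complex"
  assumes N: "CARD('k) \<ge> 2" and \<tau>: "\<tau> > 0" and s: "Re s = 0" and last0: "u last_index = 0"
    and eq: "\<And>i. i \<noteq> last_index \<Longrightarrow>
        (\<Sum>j\<in>UNIV. of_real (\<tau> * deriv (lagrange \<tau> j) (node \<tau> i)) * u j) = s * u i"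
  shows "u i = 0"
proof -
  define n where "n = CARD('k) - 1"
  have n: "n \<ge> 1" using N by (simp add: n_def)
  \<comment> \<open>Halved because the derivative in x of the substitution carries the factor
    \<tau>/2, whereas the collocation equations carry \<tau>.\<close>
  define s' where "s' = s / 2"
  define \<theta> where "\<theta> x = \<tau> / 2 * (cos x - 1)" for x
  define \<phi> where "\<phi> l = real l * pi / real n" for l
  define expands where "expands j b \<longleftrightarrow>
      (\<forall>x. lagrange \<tau> j (\<theta> x) = (\<Sum>m\<le>n. cos (real m * x) * b m))
      \<and> (\<forall>x. \<tau> / 2 * deriv (lagrange \<tau> j) (\<theta> x) * sin x = (\<Sum>m\<le>n. real m * sin (real m * x) * b m))
      \<and> \<tau> / 2 * deriv (lagrange \<tau> j) (- \<tau>) = (\<Sum>m\<le>n. - ((real m)\<^sup>2 * (- 1) ^ m) * b m)"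
    for j :: 'k and b
  have "\<exists>b. expands j b" for j
  proof (rule lagrange_cos_expansion[of \<tau> j])
    fix b
    assume b: "\<And>x. lagrange \<tau> j (\<tau> / 2 * (cos x - 1)) = (\<Sum>m\<le>CARD('k) - 1. b m * cos (real m * x))"
      "\<And>x. \<tau> / 2 * deriv (lagrange \<tau> j) (\<tau> / 2 * (cos x - 1)) * sin x = (\<Sum>m\<le>CARD('k) - 1. real m * b m * sin (real m * x))"
      "\<tau> / 2 * deriv (lagrange \<tau> j) (- \<tau>) = - (\<Sum>m\<le>CARD('k) - 1. (real m)\<^sup>2 * b m * (- 1) ^ m)"
    have "lagrange \<tau> j (\<theta> x) = (\<Sum>m\<le>n. cos (real m * x) * b m)"
      "\<tau> / 2 * deriv (lagrange \<tau> j) (\<theta> x) * sin x = (\<Sum>m\<le>n. real m * sin (real m * x) * b m)" for x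
      unfolding \<theta>_def n_def b by (simp_all only: mult_ac)
    moreover have "\<tau> / 2 * deriv (lagrange \<tau> j) (- \<tau>) = (\<Sum>m\<le>n. - ((real m)\<^sup>2 * (- 1) ^ m) * b m)"
      unfolding n_def b by (simp add: sum_negf mult_ac)
    ultimately have "expands j b" by (simp add: expands_def)
    then show ?thesis by blast
  qed
  then obtain A where A_expands: "\<And>j. expands j (A j)" by metis
  have A: "lagrange \<tau> j (\<theta> x) = (\<Sum>m\<le>n. cos (real m * x) * A j m)"
      "\<tau> / 2 * deriv (lagrange \<tau> j) (\<theta> x) * sin x = (\<Sum>m\<le>n. real m * sin (real m * x) * A j m)"
      "\<tau> / 2 * deriv (lagrange \<tau> j) (- \<tau>) = (\<Sum>m\<le>n. - ((real m)\<^sup>2 * (- 1) ^ m) * A j m)" for j x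
    using A_expands[of j] unfolding expands_def by blast+
  define a where "a m = (\<Sum>j\<in>UNIV. u j * of_real (A j m))" for m
  have comb: "(\<Sum>j\<in>UNIV. u j * of_real (\<Sum>m\<le>n. w m * A j m)) = (\<Sum>m\<le>n. of_real (w m) * a m)" for w
    by (simp add: a_def sum_distrib_left mult_ac) (rule sum.swap)
  define F where "F x = (\<Sum>j\<in>UNIV. u j * of_real (lagrange \<tau> j (\<theta> x)))" for x
  define D where "D x = (\<Sum>j\<in>UNIV. u j * of_real (\<tau> / 2 * deriv (lagrange \<tau> j) (\<theta> x)))" for x
  have F: "F x = (\<Sum>m\<le>n. of_real (cos (real m * x)) * a m)" for x
    unfolding F_def A comb ..
  have D_sin: "D x * of_real (sin x) = (\<Sum>m\<le>n. of_real (real m * sin (real m * x)) * a m)" for x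
    unfolding comb[symmetric] A(2)[symmetric] by (simp add: D_def sum_distrib_right mult.assoc)
  have "\<theta> pi = - \<tau>" by (simp add: \<theta>_def)
  then have D_pi: "D pi = (\<Sum>m\<le>n. of_real (- ((real m)\<^sup>2 * (- 1) ^ m)) * a m)"
    unfolding comb[symmetric] A(3)[symmetric] by (simp add: D_def)
  have node_at: "\<exists>i :: 'k. node \<tau> i = \<theta> (\<phi> l) \<and> index_rank i = n - l" if "l \<le> n" for l
  proof -
    have "n - l \<in> range (index_rank :: 'k \<Rightarrow> nat)" using N by (auto simp: index_rank_image n_def)
    then obtain i :: 'k where i: "index_rank i = n - l" by (metis rangeE)
    have "n - (n - l) = l" using that by simp
    then have "node \<tau> i = \<theta> (\<phi> l)"
      unfolding node_eq n_def[symmetric] i by (simp add: \<theta>_def \<phi>_def)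
    with i show ?thesis by blast
  qed
  have F_node: "F x = u i" if "node \<tau> i = \<theta> x" for x i
    by (simp add: F_def flip: that)
      (simp add: lagrange_node[OF N \<tau>] if_distrib[of of_real] if_distrib[of "\<lambda>r. _ * r"] cong: if_cong)
  have F_0: "F 0 = 0"
  proof -
    from node_at[of 0] obtain i :: 'k where i: "node \<tau> i = \<theta> (\<phi> 0)" "index_rank i = n" by auto
    then have "i = last_index"
      using strict_mono_imp_inj_on[OF index_rank_strict_mono] index_rank_last by (metis n_def injD)
    with F_node[of i 0] i last0 show ?thesis by (simp add: \<phi>_def)
  qed
  have colloc: "D (\<phi> l) = s' * F (\<phi> l)" if l: "1 \<le> l" "l \<le> n" for l
  proof -
    from node_at[OF l(2)] obtain i :: 'k where i: "node \<tau> i = \<theta> (\<phi> l)" "index_rank i = n - l" by auto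
    have "i \<noteq> last_index" using i(2) l index_rank_last[where 'k = 'k] by (auto simp: n_def)
    from eq[OF this] have "2 * D (\<phi> l) = s * u i"
      by (simp add: D_def i(1) sum_distrib_left mult_ac)
    then have "D (\<phi> l) = s * u i / 2" by (metis nonzero_mult_div_cancel_left zero_neq_numeral)
    with F_node[OF i(1)] show ?thesis by (simp add: s'_def)
  qed
  \<comment> \<open>Doubling both end coefficients lets the recurrence keep one form for every m
    from 1 to n - 1: the first doubling absorbs the constant term, the second the aliasing of
    frequency n + 1 at the nodes.\<close>
  define c where "c m = (if m = 0 \<or> m = n then 2 * a m else a m)" for m
  have ends: "(\<Sum>m\<le>n. w m * a m) = w 0 * c 0 / 2 + (\<Sum>m = 1..<n. w m * c m) + w n * c n / 2" for w
  proof -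
    have "{..n} = insert 0 (insert n {1..<n})" using n by auto
    then show ?thesis using n by (simp add: c_def)
  qed
  have rec: "s' * (c (m - 1) - c (m + 1)) = 2 * of_nat m * c m" if m: "1 \<le> m" "m < n" for m
  proof -
    \<comment> \<open>The collocation residual times sin x is, at the interior nodes, a sine sum
      with frequencies 1 to n - 1 only. It vanishes there, so each coefficient vanishes, and that is
      the recurrence.\<close>
    have "(\<Sum>m = 1..<n. (2 * of_nat m * c m - s' * (c (m - 1) - c (m + 1)))
        * of_real (sin (real m * (real l * pi / real n)))) = 0" if l: "1 \<le> l" "l < n" for l
    proof -
      define S where "S m = complex_of_real (sin (real m * \<phi> l))" for m
      have S0: "S 0 = 0" by (simp add: S_def)
      have "real n * \<phi> l = real l * pi" using n by (simp add: \<phi>_def)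
      then have Sn: "S n = 0" and cos_n: "sin (real n * \<phi> l) = 0" by (simp_all add: S_def)
      have D2: "2 * (D (\<phi> l) * of_real (sin (\<phi> l))) = (\<Sum>m = 1..<n. 2 * of_nat m * c m * S m)"
        unfolding D_sin ends using cos_n by (simp add: S_def sum_distrib_left mult_ac)
      have two: "2 * of_real (sin (\<phi> l)) * of_real (cos (real m * \<phi> l)) = S (m + 1) - S (m - 1)"
        if "m \<ge> 1" for m
      proof -
        have "2 * sin (\<phi> l) * cos (real m * \<phi> l) = sin (real (m + 1) * \<phi> l) - sin (real (m - 1) * \<phi> l)"
          using that by (simp add: of_nat_diff algebra_simps sin_add sin_diff)
        then show ?thesis unfolding S_def by (metis of_real_diff of_real_mult of_real_numeral)
      qed
      \<comment> \<open>Aliasing: at an interior node the frequency n + 1 is indistinguishable from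
        -(n - 1).\<close>
      have Sn1: "S (n + 1) = - S (n - 1)"
        using two[OF n] n \<open>real n * \<phi> l = real l * pi\<close>
        by (simp add: S_def of_nat_diff algebra_simps sin_add sin_diff)
      have "2 * (of_real (sin (\<phi> l)) * F (\<phi> l))
          = (\<Sum>m\<le>n. 2 * of_real (sin (\<phi> l)) * of_real (cos (real m * \<phi> l)) * a m)"
        unfolding F by (simp add: sum_distrib_left mult_ac)
      also have "\<dots> = S 1 * c 0 + (\<Sum>m = 1..<n. (S (m + 1) - S (m - 1)) * c m) + (S (n + 1) - S (n - 1)) * c n / 2"
        unfolding ends using two n by (simp add: S_def)
      also have "\<dots> = S 1 * c 0 + (\<Sum>m = 1..<n. S (m + 1) * c m) - (\<Sum>m = 1..<n. S (m - 1) * c m) - S (n - 1) * c n"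
        unfolding Sn1 by (simp add: sum_subtractf left_diff_distrib)
      also have "S 1 * c 0 + (\<Sum>m = 1..<n. S (m + 1) * c m) = (\<Sum>m = 0..<n. S (m + 1) * c m)"
        using n by (simp add: sum.atLeast_Suc_lessThan)
      also have "\<dots> = (\<Sum>m = 1..<Suc n. S m * c (m - 1))"
        using sum.shift_bounds_Suc_ivl[of "\<lambda>m. S m * c (m - 1)" 0 n] by simp
      also have "\<dots> = (\<Sum>m = 1..<n. S m * c (m - 1))" using n Sn by simp
      also have "(\<Sum>m = 1..<n. S m * c (m - 1)) - (\<Sum>m = 1..<n. S (m - 1) * c m) - S (n - 1) * c n
          = (\<Sum>m = 1..<n. S m * c (m - 1)) - (\<Sum>m = 1..<Suc n. S (m - 1) * c m)"
        using n by simp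
      also have "(\<Sum>m = 1..<Suc n. S (m - 1) * c m) = (\<Sum>m = 0..<n. S m * c (m + 1))"
        using sum.shift_bounds_Suc_ivl[of "\<lambda>m. S (m - 1) * c m" 0 n] by simp
      also have "\<dots> = (\<Sum>m = 1..<n. S m * c (m + 1))"
        using n S0 by (simp add: sum.atLeast_Suc_lessThan)
      also have "(\<Sum>m = 1..<n. S m * c (m - 1)) - (\<Sum>m = 1..<n. S m * c (m + 1))
          = (\<Sum>m = 1..<n. (c (m - 1) - c (m + 1)) * S m)"
        by (simp add: sum_subtractf algebra_simps)
      finally have F2: "2 * (of_real (sin (\<phi> l)) * F (\<phi> l)) = (\<Sum>m = 1..<n. (c (m - 1) - c (m + 1)) * S m)" .
      have "(\<Sum>m = 1..<n. (2 * of_nat m * c m - s' * (c (m - 1) - c (m + 1))) * S m)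
          = (\<Sum>m = 1..<n. 2 * of_nat m * c m * S m) - s' * (\<Sum>m = 1..<n. (c (m - 1) - c (m + 1)) * S m)"
        unfolding sum_distrib_left sum_subtractf[symmetric]
        by (rule sum.cong) (simp_all add: algebra_simps)
      also have "\<dots> = 0"
        unfolding D2[symmetric] F2[symmetric] using colloc[of l] l by simp
      finally show ?thesis by (simp add: S_def \<phi>_def)
    qed
    from discrete_sine_independent[OF this m] show ?thesis by simp
  qed
  \<comment> \<open>The node -\<tau> is invisible to the sine argument. In its own equation the
    recurrence replaces each \<open>(of_nat m)\<^sup>2 * c m\<close>, the value \<open>F pi\<close>
    cancels, and a common factor n remains.\<close>
  have last: "s' * (c (n - 1) - c n) = of_nat n * c n"
  proof -
    define \<epsilon> where "\<epsilon> = (- 1 :: complex) ^ n"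
    have \<epsilon>: "\<epsilon> * \<epsilon> = 1" by (simp add: \<epsilon>_def flip: power_mult_distrib)
    have phi_n: "\<phi> n = pi" using n by (simp add: \<phi>_def)
    have "F pi = (\<Sum>m\<le>n. (- 1) ^ m * a m)" unfolding F by simp
    then have F_pi: "2 * F pi = c 0 + 2 * (\<Sum>m = 1..<n. (- 1) ^ m * c m) + \<epsilon> * c n"
      unfolding ends by (simp add: \<epsilon>_def)
    have "D pi = (\<Sum>m\<le>n. - ((of_nat m)\<^sup>2 * (- 1) ^ m) * a m)" unfolding D_pi by simp
    then have "2 * D pi = 2 * (\<Sum>m = 1..<n. - ((of_nat m)\<^sup>2 * (- 1) ^ m) * c m) - (of_nat n)\<^sup>2 * \<epsilon> * c n"
      unfolding ends by (simp add: \<epsilon>_def)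
    also have "2 * (\<Sum>m = 1..<n. - ((of_nat m)\<^sup>2 * (- 1) ^ m) * c m)
        = - s' * (\<Sum>m = 1..<n. of_nat m * (- 1) ^ m * (c (m - 1) - c (m + 1)))"
      unfolding sum_distrib_left
    proof (rule sum.cong)
      fix m assume "m \<in> {1..<n}"
      with rec[of m] have r: "s' * (c (m - 1) - c (m + 1)) = 2 * of_nat m * c m" by simp
      have eq: "- s' * (of_nat m * (- 1) ^ m * (c (m - 1) - c (m + 1)))
          = - (of_nat m * (- 1) ^ m) * (s' * (c (m - 1) - c (m + 1)))" by (simp add: mult_ac)
      then show "2 * (- ((of_nat m)\<^sup>2 * (- 1) ^ m) * c m) = - s' * (of_nat m * (- 1) ^ m * (c (m - 1) - c (m + 1)))"
        unfolding eq r by (simp add: power2_eq_square mult_ac)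
    qed simp
    finally have "2 * D pi = s' * (c 0 + 2 * (\<Sum>m = 1..<n. (- 1) ^ m * c m)
        + of_nat n * \<epsilon> * c (n - 1) - (of_nat n - 1) * \<epsilon> * c n) - (of_nat n)\<^sup>2 * \<epsilon> * c n"
      unfolding alternating_weighted_sum[OF n] using n by (simp add: \<epsilon>_def of_nat_diff algebra_simps)
    moreover have "2 * D pi = s' * (2 * F pi)" using colloc[of n] n phi_n by simp
    ultimately have "\<epsilon> * (of_nat n * (s' * (c (n - 1) - c n))) = \<epsilon> * (of_nat n * (of_nat n * c n))"
      unfolding F_pi by (simp add: power2_eq_square algebra_simps)
    with \<epsilon> n show ?thesis by auto
  qed
  have "F 0 = (\<Sum>m\<le>n. 1 * a m)" unfolding F by simp
  then have "c 0 / 2 + (\<Sum>m = 1..<n. c m) + c n / 2 = 0" unfolding ends F_0 by simp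
  moreover have "Re s' = 0" using s by (simp add: s'_def)
  ultimately have c0: "c m = 0" if "m \<le> n" for m
    using imaginary_chebyshev_recurrence_trivial[OF n _ rec last _ that] by simp
  have "a m = 0" if "m \<le> n" for m using c0[OF that] by (simp add: c_def split: if_splits)
  then have "F x = 0" for x unfolding F by simp
  moreover have "\<exists>x. node \<tau> i = \<theta> x" unfolding node_eq \<theta>_def by blast
  ultimately show ?thesis using F_node by metis
qed

section \<open>Square roots of positive semidefinite matrices\<close>

lemma inner_transpose_mult:
  fixes S :: "real ^ 'n ^ 'm"
  shows "x \<bullet> (transpose S *v y) = (S *v x) \<bullet> y"
  by (metis dot_lmul_matrix transpose_transpose vector_transpose_matrix)

text \<open>A maximizer of the quadratic form on the unit sphere of the invariant subspace is an
  eigenvector: otherwise moving it along its residual \<open>r\<close>, which stays in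
  \<open>W\<close>, increases the quotient to first order.\<close>

lemma symmetric_eigenvector_exists:
  fixes S :: "real ^ 'n ^ 'n"
  assumes sym: "transpose S = S" and W: "subspace W" and inv: "\<And>x. x \<in> W \<Longrightarrow> S *v x \<in> W"
    and nonzero: "x0 \<in> W" "x0 \<noteq> 0"
  obtains u l where "u \<in> W" "norm u = 1" "S *v u = l *\<^sub>R u"
proof -
  have swap: "x \<bullet> (S *v y) = (S *v x) \<bullet> y" for x y
    using inner_transpose_mult[of x S y] by (simp only: sym)
  define K where "K = W \<inter> sphere 0 1"
  have "compact K" unfolding K_def using closed_subspace[OF W] by (intro closed_Int_compact) auto
  moreover have "(1 / norm x0) *\<^sub>R x0 \<in> K"
    unfolding K_def using nonzero W by (simp add: subspace_scale)
  moreover have "continuous_on K (\<lambda>x. x \<bullet> (S *v x))"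
    by (intro continuous_intros matrix_vector_mult_linear_continuous_on)
  ultimately obtain u where u: "u \<in> K" and max: "\<And>x. x \<in> K \<Longrightarrow> x \<bullet> (S *v x) \<le> u \<bullet> (S *v u)"
    using continuous_attains_sup[of K "\<lambda>x. x \<bullet> (S *v x)"] by blast
  define l where "l = u \<bullet> (S *v u)"
  from u have uW: "u \<in> W" and nu: "norm u = 1" by (auto simp: K_def)
  have le: "x \<bullet> (S *v x) \<le> l * (x \<bullet> x)" if "x \<in> W" for x
  proof (cases "x = 0")
    case False
    have "(1 / norm x) *\<^sub>R x \<in> K" unfolding K_def using that False W by (simp add: subspace_scale)
    from max[OF this] have "x \<bullet> (S *v x) / (norm x)\<^sup>2 \<le> l"
      by (simp add: l_def matrix_vector_mult_scaleR power2_eq_square)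
    with False show ?thesis by (simp add: divide_le_eq power2_norm_eq_inner)
  qed simp
  define r where "r = S *v u - l *\<^sub>R u"
  have r: "r \<in> W" unfolding r_def using inv[OF uW] uW W by (simp add: subspace_diff subspace_scale)
  have uu: "u \<bullet> u = 1" using nu by (simp add: power2_norm_eq_inner[symmetric])
  then have ru: "r \<bullet> u = 0" by (simp add: r_def inner_diff_left l_def inner_commute[of "S *v u" u])
  have rS: "r \<bullet> (S *v u) = r \<bullet> r"
    using ru by (simp add: r_def inner_diff_right inner_diff_left algebra_simps inner_commute)
  have quad: "2 * t * (r \<bullet> r) + t\<^sup>2 * (r \<bullet> (S *v r) - l * (r \<bullet> r)) \<le> 0" for t
  proof -
    have "u + t *\<^sub>R r \<in> W" using uW r W by (simp add: subspace_add subspace_scale)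
    from le[OF this] show ?thesis
      using ru rS uu swap[of u r]
      by (simp add: matrix_vector_right_distrib matrix_vector_mult_scaleR inner_add_left inner_add_right
          l_def[symmetric] power2_eq_square inner_commute algebra_simps)
  qed
  have "r = 0"
  proof (rule ccontr)
    assume "r \<noteq> 0"
    define a where "a = r \<bullet> r"
    define b where "b = r \<bullet> (S *v r) - l * (r \<bullet> r)"
    have a: "a > 0" using \<open>r \<noteq> 0\<close> by (simp add: a_def)
    \<comment> \<open>This step length t satisfies t \<bar>b\<bar> \<le> a, so the quadratic term
      has size at most t a, half of the linear term 2 t a.\<close>
    have "2 * (a / (\<bar>b\<bar> + a)) * a + (a / (\<bar>b\<bar> + a))\<^sup>2 * b \<le> 0"
      using quad[of "a / (\<bar>b\<bar> + a)"] by (simp add: a_def b_def)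
    moreover have "(a / (\<bar>b\<bar> + a))\<^sup>2 * b \<ge> - (a / (\<bar>b\<bar> + a)) * a"
    proof -
      have "(a / (\<bar>b\<bar> + a)) * \<bar>b\<bar> \<le> a" using a by (simp add: field_simps)
      then have "(a / (\<bar>b\<bar> + a)) * b \<ge> - a"
        using a by (smt (verit) divide_nonneg_nonneg mult_minus_right mult_left_mono)
      then have "(a / (\<bar>b\<bar> + a)) * ((a / (\<bar>b\<bar> + a)) * b) \<ge> (a / (\<bar>b\<bar> + a)) * (- a)"
        using a by (intro mult_left_mono) auto
      then show ?thesis by (simp add: power2_eq_square algebra_simps)
    qed
    moreover have "(a / (\<bar>b\<bar> + a)) * a > 0" using a by simp
    ultimately show False by linarith
  qed
  then have "S *v u = l *\<^sub>R u" by (simp add: r_def)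
  with uW nu show thesis by (rule that)
qed

text \<open>A largest orthonormal set of eigenvectors spans: its orthogonal complement is invariant
  by symmetry, so if it were nonzero it would contain one more eigenvector.\<close>

lemma symmetric_orthonormal_eigenbasis:
  fixes S :: "real ^ 'n ^ 'n"
  assumes sym: "transpose S = S"
  obtains B l where "finite B" "pairwise orthogonal B" "\<And>b. b \<in> B \<Longrightarrow> norm b = 1"
    "span B = UNIV" "\<And>b. b \<in> B \<Longrightarrow> S *v b = l b *\<^sub>R b"
proof -
  define good where "good B \<longleftrightarrow> finite B \<and> pairwise orthogonal B \<and>
      (\<forall>b\<in>B. norm b = 1 \<and> (\<exists>l. S *v b = l *\<^sub>R b))" for B :: "(real ^ 'n) set"
  have ind: "independent B" if "good B" for B
    using that unfolding good_def by (intro pairwise_orthogonal_independent) auto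
  have "card B \<le> DIM(real ^ 'n)" if "good B" for B
    using independent_bound[OF ind[OF that]] by simp
  moreover have "good {}" by (simp add: good_def)
  ultimately obtain B where B: "good B" and max: "\<And>C. good C \<Longrightarrow> card C \<le> card B"
    using ex_has_greatest_nat[of good "{}" card "DIM(real ^ 'n) + 1"] by (metis less_Suc_eq_le Suc_eq_plus1)
  have "span B = UNIV"
  proof (rule ccontr)
    assume "span B \<noteq> UNIV"
    then have "dim B < DIM(real ^ 'n)" by (metis dim_eq_full dim_subset_UNIV le_neq_implies_less)
    then obtain x0 where x0: "x0 \<noteq> 0" "\<And>y. y \<in> span B \<Longrightarrow> orthogonal x0 y"
      by (rule orthogonal_to_subspace_exists) blast
    define W where "W = {x. \<forall>b\<in>B. b \<bullet> x = 0}"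
    have W: "subspace W" by (auto simp: W_def subspace_def inner_add_right)
    have inv: "S *v x \<in> W" if x: "x \<in> W" for x
      unfolding W_def
    proof (intro CollectI ballI)
      fix b assume b: "b \<in> B"
      with B obtain l where l: "S *v b = l *\<^sub>R b" by (auto simp: good_def)
      have "b \<bullet> (S *v x) = (S *v b) \<bullet> x" using inner_transpose_mult[of b S x] by (simp only: sym)
      with x b l show "b \<bullet> (S *v x) = 0" by (simp add: W_def)
    qed
    have "x0 \<in> W" using x0(2) by (auto simp: W_def orthogonal_def inner_commute span_base)
    from symmetric_eigenvector_exists[OF sym W inv this x0(1)]
    obtain u l where u: "u \<in> W" "norm u = 1" "S *v u = l *\<^sub>R u" by metis
    have "u \<notin> B" using u by (auto simp: W_def)
    moreover have "good (insert u B)"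
      using B u by (auto simp: good_def pairwise_insert orthogonal_def W_def inner_commute)
    ultimately show False using max[of "insert u B"] B by (simp add: good_def)
  qed
  moreover from B obtain l where "\<And>b. b \<in> B \<Longrightarrow> S *v b = l b *\<^sub>R b"
    unfolding good_def by metis
  ultimately show thesis using B that[of B l] by (auto simp: good_def)
qed

text \<open>\<open>msqrt\<close> is a choice, so a root must be exhibited before anything is known
  about it: take square roots of the eigenvalues in an orthonormal eigenbasis.\<close>

lemma msqrt_psd:
  assumes "psd S"
  shows "psd (msqrt S)" "msqrt S ** msqrt S = S"
proof -
  from assms have sym: "transpose S = S" and nonneg: "\<And>x. 0 \<le> x \<bullet> (S *v x)" by (auto simp: psd_def)
  from symmetric_orthonormal_eigenbasis[OF sym] obtain B l
    where fin: "finite B" and orth: "pairwise orthogonal B" and unit: "\<And>b. b \<in> B \<Longrightarrow> norm b = 1"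
      and span: "span B = UNIV" and eig: "\<And>b. b \<in> B \<Longrightarrow> S *v b = l b *\<^sub>R b" by blast
  have l: "l b \<ge> 0" if "b \<in> B" for b
    using nonneg[of b] that unit[OF that] by (simp add: eig flip: power2_norm_eq_inner)
  have expand: "(\<Sum>b\<in>B. (x \<bullet> b) *\<^sub>R b) = x" for x
    using fin orth unit span by (intro orthonormal_basis_expand) auto
  define g where "g x = (\<Sum>b\<in>B. (sqrt (l b) * (x \<bullet> b)) *\<^sub>R b)" for x
  define T where "T = matrix g"
  have lin: "linear g" unfolding g_def
    by (intro linearI) (simp_all add: inner_add_left algebra_simps sum.distrib scaleR_sum_right)
  have T: "T *v x = g x" for x unfolding T_def using lin by simp
  have g_inner: "g x \<bullet> c = sqrt (l c) * (x \<bullet> c)" if "c \<in> B" for x c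
  proof -
    have "g x \<bullet> c = (\<Sum>b\<in>B. sqrt (l b) * (x \<bullet> b) * (b \<bullet> c))" by (simp add: g_def inner_sum_left)
    also have "\<dots> = (\<Sum>b\<in>B. if b = c then sqrt (l c) * (x \<bullet> c) else 0)"
      using orth unit that by (intro sum.cong) (auto simp: pairwise_def orthogonal_def norm_eq_1)
    finally show ?thesis using that fin by simp
  qed
  have dot: "y \<bullet> g x = (\<Sum>b\<in>B. sqrt (l b) * (x \<bullet> b) * (y \<bullet> b))" for x y
    by (simp add: g_def inner_sum_right)
  have "T ** T = S"
  proof (intro matrix_eq[THEN iffD2] allI)
    fix x
    have "(T ** T) *v x = g (g x)" by (simp add: T flip: matrix_vector_mul_assoc)
    also have "\<dots> = (\<Sum>b\<in>B. (l b * (x \<bullet> b)) *\<^sub>R b)"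
      unfolding g_def[of "g x"] using l by (intro sum.cong) (simp_all add: g_inner flip: mult.assoc)
    also have "\<dots> = S *v (\<Sum>b\<in>B. (x \<bullet> b) *\<^sub>R b)"
      by (simp add: linear_sum[OF matrix_vector_mul_linear] matrix_vector_mult_scaleR eig mult.commute)
    finally show "(T ** T) *v x = S *v x" by (simp add: expand)
  qed
  moreover have "psd T"
  proof -
    have "transpose T = T"
    proof (intro matrix_eq[THEN iffD2] allI)
      fix x
      have "y \<bullet> (transpose T *v x) = y \<bullet> (T *v x)" for y
        unfolding inner_transpose_mult T by (subst inner_commute) (simp add: dot mult_ac)
      then show "transpose T *v x = T *v x" by (metis vector_eq_rdot inner_commute)
    qed
    moreover have "0 \<le> x \<bullet> (T *v x)" for x
      unfolding T dot using l by (intro sum_nonneg) (simp add: mult.assoc)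
    ultimately show ?thesis by (simp add: psd_def)
  qed
  ultimately have "\<exists>T. psd T \<and> T ** T = S" by blast
  then have "psd (msqrt S) \<and> msqrt S ** msqrt S = S" unfolding msqrt_def by (rule someI_ex)
  then show "psd (msqrt S)" "msqrt S ** msqrt S = S" by auto
qed

lemma msqrt_norm_square:
  assumes "psd S"
  shows "(norm (msqrt S *v x))\<^sup>2 = x \<bullet> (S *v x)"
proof -
  have "(norm (msqrt S *v x))\<^sup>2 = x \<bullet> (transpose (msqrt S) *v (msqrt S *v x))"
    by (simp only: inner_transpose_mult power2_norm_eq_inner)
  also have "\<dots> = x \<bullet> (S *v x)"
    using msqrt_psd[OF assms] by (metis matrix_vector_mul_assoc psd_def)
  finally show ?thesis .
qed

section \<open>Paths of matrices whose spectrum avoids the imaginary axis\<close>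

lemma complex_eigenvalue_iff_det:
  "complex_eigenvalue S z \<longleftrightarrow> det (mat z - map_matrix complex_of_real S) = 0"
proof -
  have "complex_eigenvalue S z \<longleftrightarrow>
      (\<exists>v. v \<noteq> 0 \<and> (mat z - map_matrix complex_of_real S) *v v = 0)"
  proof -
    have "mat z *v v = z *s v" for v :: "complex ^ 'a"
      by (simp add: vec_eq_iff matrix_vector_mult_def mat_def if_distribR if_distrib cong: if_cong)
    then have "map_matrix complex_of_real S *v v = z *s v \<longleftrightarrow> (mat z - map_matrix complex_of_real S) *v v = 0" for v
      by (auto simp: matrix_vector_mult_diff_rdistrib)
    then show ?thesis by (simp only: complex_eigenvalue_def)
  qed
  also have "\<dots> \<longleftrightarrow> \<not> invertible (mat z - map_matrix complex_of_real S)"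
    unfolding invertible_left_inverse matrix_left_invertible_ker by blast
  finally show ?thesis by (simp add: invertible_det_nz)
qed

text \<open>Evaluate the eigenvalue equation at the largest component of the eigenvector. The full
  sum of entries is cruder than a row sum, but it is evidently continuous in the matrix and so
  confines all spectra along a path to one disc.\<close>

lemma complex_eigenvalue_norm_le:
  assumes "complex_eigenvalue S z"
  shows "norm z \<le> (\<Sum>i\<in>UNIV. \<Sum>j\<in>UNIV. \<bar>S $ i $ j\<bar>)"
proof -
  from assms obtain v where v: "v \<noteq> 0" "map_matrix complex_of_real S *v v = z *s v"
    unfolding complex_eigenvalue_def by blast
  define M where "M = Max (range (\<lambda>i. norm (v $ i)))"
  have le: "norm (v $ i) \<le> M" for i unfolding M_def by (intro Max_ge) auto
  have "M \<in> range (\<lambda>i. norm (v $ i))" unfolding M_def by (intro Max_in) auto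
  then obtain i where i: "norm (v $ i) = M" by auto
  from v(1) obtain k where "v $ k \<noteq> 0" by (auto simp: vec_eq_iff)
  with le[of k] have M: "M > 0" by (metis less_le_trans zero_less_norm_iff)
  have "z * v $ i = (\<Sum>j\<in>UNIV. complex_of_real (S $ i $ j) * v $ j)"
    using arg_cong[OF v(2), of "\<lambda>x. x $ i"] by (simp add: matrix_vector_mult_def map_matrix_def)
  then have "norm z * M = norm (\<Sum>j\<in>UNIV. complex_of_real (S $ i $ j) * v $ j)"
    unfolding i[symmetric] norm_mult[symmetric] by (rule arg_cong)
  also have "\<dots> \<le> (\<Sum>j\<in>UNIV. \<bar>S $ i $ j\<bar> * M)"
    by (rule sum_norm_le) (simp add: norm_mult le mult_left_mono)
  also have "\<dots> = (\<Sum>j\<in>UNIV. \<bar>S $ i $ j\<bar>) * M" by (simp add: sum_distrib_right)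
  finally have "norm z \<le> (\<Sum>j\<in>UNIV. \<bar>S $ i $ j\<bar>)" using M by simp
  also have "\<dots> \<le> (\<Sum>i\<in>UNIV. \<Sum>j\<in>UNIV. \<bar>S $ i $ j\<bar>)"
    by (rule member_le_sum) (auto intro: sum_nonneg)
  finally show ?thesis .
qed

lemma continuous_on_map_matrix_of_real [continuous_intros]:
  assumes "continuous_on T f"
  shows "continuous_on T (\<lambda>x. map_matrix complex_of_real (f x))"
  using assms unfolding map_matrix_def
  by (intro continuous_on_vec_lambda continuous_intros) 

lemma continuous_on_det [continuous_intros]:
  fixes f :: "'a::topological_space \<Rightarrow> complex ^ 'n ^ 'n"
  assumes "continuous_on T f"
  shows "continuous_on T (\<lambda>x. det (f x))"
  using assms unfolding det_def by (intro continuous_intros)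

lemma continuous_on_mat [continuous_intros]:
  fixes f :: "'a::topological_space \<Rightarrow> complex"
  assumes "continuous_on T f"
  shows "continuous_on T (\<lambda>x. mat (f x) :: complex ^ 'n ^ 'n)"
  unfolding mat_def
proof (intro continuous_on_vec_lambda)
  show "continuous_on T (\<lambda>x. if i = j then f x else 0)" for i j :: 'n
    using assms by (cases "i = j") auto
qed

lemma holomorphic_on_char_det:
  "(\<lambda>z. det (mat z - map_matrix complex_of_real S)) holomorphic_on T"
proof -
  have "(\<lambda>z. (mat z - map_matrix complex_of_real S :: complex ^ 'a ^ 'a) $ i $ j) holomorphic_on T" for i j
    by (cases "i = j") (auto simp: mat_def intro!: holomorphic_intros)
  then show ?thesis unfolding det_def by (intro holomorphic_intros)
qed

text \<open>Along the path the eigenvalues can leave the open left half-plane only through the imaginary axis.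
  Openness of the Hurwitz set of parameters is compactness of the spectrum in the closed right half-plane;
  closedness is Hurwitz's theorem on limits of zero-free functions.\<close>

lemma hurwitz_path:
  fixes A :: "real \<Rightarrow> real ^ 'n ^ 'n"
  assumes cont: "continuous_on {0..1} A"
    and start: "hurwitz (A 0)"
    and noimag: "\<And>t z. 0 \<le> t \<Longrightarrow> t \<le> 1 \<Longrightarrow> Re z = 0 \<Longrightarrow> \<not> complex_eigenvalue (A t) z"
  shows "hurwitz (A 1)"
proof -
  define f where "f = (\<lambda>(t, z). det (mat z - map_matrix complex_of_real (A t)))"
  have f: "complex_eigenvalue (A t) z \<longleftrightarrow> f (t, z) = 0" for t z
    by (simp add: f_def complex_eigenvalue_iff_det)
  have cont_f: "continuous_on ({0..1} \<times> UNIV) f"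
    unfolding f_def case_prod_unfold
    by (intro continuous_intros continuous_on_compose2[OF cont]) auto
  define T where "T = {t \<in> {0..1}. hurwitz (A t)}"
  define m where "m t = (\<Sum>i\<in>UNIV. \<Sum>j\<in>UNIV. \<bar>A t $ i $ j\<bar>)" for t
  have "continuous_on {0..1} m" unfolding m_def
    by (intro continuous_intros cont)
  then have "bounded (m ` {0..1})" by (intro compact_imp_bounded compact_continuous_image) auto
  then obtain M where "\<forall>t\<in>{0..1}. \<bar>m t\<bar> \<le> M" unfolding bounded_iff by auto
  then have M: "m t \<le> M" if "t \<in> {0..1}" for t using that by (meson abs_le_D1)
  have open_T: "openin (top_of_set {0..1}) T"
  proof -
    define E where "E = ({0..1} \<times> (cball 0 M \<inter> {z. Re z \<ge> 0})) \<inter> f -` {0}"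
    have cpt: "compact ({0..1::real} \<times> (cball 0 M \<inter> {z. Re z \<ge> 0}))"
      by (intro compact_Times compact_Int_closed closed_halfspace_Re_ge) auto
    have "closedin (top_of_set ({0..1} \<times> (cball 0 M \<inter> {z. Re z \<ge> 0}))) E"
      unfolding E_def
      by (intro continuous_closedin_preimage continuous_on_subset[OF cont_f]) auto
    with cpt have "compact E" using closedin_compact by blast
    then have "compact (fst ` E)" by (intro compact_continuous_image continuous_intros)
    moreover have "{0..1} - T = fst ` E"
    proof (intro subset_antisym subsetI)
      fix t assume "t \<in> {0..1} - T"
      then obtain z where t: "t \<in> {0..1}" and z: "complex_eigenvalue (A t) z" "Re z \<ge> 0"
        by (force simp: T_def hurwitz_def)
      with complex_eigenvalue_norm_le[OF z(1)] M[OF t] have "(t, z) \<in> E"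
        by (simp add: E_def m_def f)
      then show "t \<in> fst ` E" by force
    next
      fix t assume "t \<in> fst ` E"
      then show "t \<in> {0..1} - T" by (force simp: T_def E_def hurwitz_def f)
    qed
    ultimately have "closedin (top_of_set {0..1}) ({0..1} - T)"
      by (metis closed_subset compact_imp_closed Diff_subset)
    then show ?thesis
      by (metis (no_types, lifting) T_def mem_Collect_eq openin_closedin_eq subsetI topspace_euclidean_subtopology)
  qed
  have closed_T: "closedin (top_of_set {0..1}) T"
    unfolding closedin_limpt
  proof (intro conjI allI impI)
    show "T \<subseteq> {0..1}" by (auto simp: T_def)
    fix t assume t: "t islimpt T \<and> t \<in> {0..1}"
    then obtain u where u: "\<And>k. u k \<in> T" "u \<longlonglongrightarrow> t"
      unfolding islimpt_sequential by blast
    let ?S = "{z. Re z > 0}"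
    have "\<not> complex_eigenvalue (A t) z0" if z0: "Re z0 > 0" for z0
    proof
      assume "complex_eigenvalue (A t) z0"
      then have root: "f (t, z0) = 0" by (simp add: f)
      have "f (t, z0) \<noteq> 0"
      proof (rule Hurwitz_no_zeros[of ?S "\<lambda>k z. f (u k, z)" "\<lambda>z. f (t, z)"])
        show "open ?S" by (rule open_halfspace_Re_gt)
        show "connected ?S" by (intro convex_connected convex_halfspace_Re_gt)
        show "(\<lambda>z. f (u k, z)) holomorphic_on ?S" for k
          unfolding f_def by (simp add: holomorphic_on_char_det)
        show "(\<lambda>z. f (t, z)) holomorphic_on ?S"
          unfolding f_def by (simp add: holomorphic_on_char_det)
        show "f (u k, z) \<noteq> 0" if "z \<in> ?S" for k z
          using u(1)[of k] that by (force simp: T_def hurwitz_def f)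
        show "z0 \<in> ?S" using z0 by simp
        show "\<not> (\<lambda>z. f (t, z)) constant_on ?S"
        proof
          assume "(\<lambda>z. f (t, z)) constant_on ?S"
          \<comment> \<open>A real test point beyond the eigenvalue bound; a constant function with
            the root \<open>z0\<close> would make it an eigenvalue.\<close>
          then have "f (t, of_real (\<bar>m t\<bar> + 1)) = f (t, z0)"
            using z0 unfolding constant_on_def by (metis Re_complex_of_real abs_ge_zero add_nonneg_pos mem_Collect_eq zero_less_one)
          then have "norm (of_real (\<bar>m t\<bar> + 1) :: complex) \<le> m t"
            unfolding m_def[of t] using root f complex_eigenvalue_norm_le by metis
          then show False unfolding norm_of_real by linarith
        qed
        show "uniform_limit K (\<lambda>k z. f (u k, z)) (\<lambda>z. f (t, z)) sequentially"
          if K: "compact K" "K \<subseteq> ?S" for K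
        proof -
          have "uniformly_continuous_on ({0..1} \<times> K) f"
            by (intro compact_uniformly_continuous continuous_on_subset[OF cont_f] compact_Times K) auto
          show ?thesis
          proof (rule uniform_limitI)
            fix e :: real assume "e > 0"
            then obtain d where d: "d > 0"
              "\<And>p q. p \<in> {0..1} \<times> K \<Longrightarrow> q \<in> {0..1} \<times> K \<Longrightarrow> dist q p < d \<Longrightarrow> dist (f q) (f p) < e"
              using \<open>uniformly_continuous_on ({0..1} \<times> K) f\<close>
              unfolding uniformly_continuous_on_def by metis
            from u(2) d(1) have "\<forall>\<^sub>F k in sequentially. dist (u k) t < d" by (rule tendstoD)
            then show "\<forall>\<^sub>F k in sequentially. \<forall>z\<in>K. dist (f (u k, z)) (f (t, z)) < e"
            proof eventually_elim
              case (elim k)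
              then show ?case using u(1)[of k] t
                by (auto intro!: d(2) simp: T_def dist_Pair_Pair)
            qed
          qed
        qed
      qed
      with root show False by simp
    qed
    moreover have "\<not> complex_eigenvalue (A t) z0" if "Re z0 = 0" for z0
      using noimag that t by auto
    ultimately have "hurwitz (A t)"
      unfolding hurwitz_def by (meson linorder_neqE_linordered_idom)
    with t show "t \<in> T" by (simp add: T_def)
  qed
  have "connected {0..1::real}" by simp
  with open_T closed_T have "T = {} \<or> T = {0..1}" by (auto simp: connected_clopen)
  moreover have "0 \<in> T" using start by (simp add: T_def)
  ultimately have "1 \<in> T" by auto
  then show ?thesis by (simp add: T_def)
qed

section \<open>The closed loop\<close>

lemma norm_mult_le_spectral_norm: "norm (S *v x) \<le> spectral_norm S * norm x"
  for S :: "real ^ 'n ^ 'm"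
  unfolding spectral_norm_def by (rule onorm[OF matrix_vector_mul_bounded_linear])

lemma spectral_norm_nonneg: "0 \<le> spectral_norm S"
  for S :: "real ^ 'n ^ 'm"
  unfolding spectral_norm_def by (rule onorm_pos_le[OF matrix_vector_mul_bounded_linear])

lemma matrix_mult_add_left: "(S + T) ** V = S ** V + T ** V"
  for S T :: "real ^ 'n ^ 'm"
  by (simp add: matrix_matrix_mult_def vec_eq_iff distrib_right sum.distrib)

lemma matrix_vector_mult_minus_left: "(- S) *v x = - (S *v x)"
  for S :: "real ^ 'n ^ 'm"
  by (simp add: matrix_vector_mult_def vec_eq_iff sum_negf)

text \<open>Splitting the eigenvector into real and imaginary parts keeps the Lyapunov and
  detectability arguments within real inner product spaces.\<close>

lemma complex_eigenvalue_iff_real_pair: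
  "complex_eigenvalue S z \<longleftrightarrow> (\<exists>x y. (x \<noteq> 0 \<or> y \<noteq> 0) \<and>
     S *v x = Re z *\<^sub>R x - Im z *\<^sub>R y \<and> S *v y = Im z *\<^sub>R x + Re z *\<^sub>R y)"
proof
  assume "complex_eigenvalue S z"
  then obtain v where v: "v \<noteq> 0" "map_matrix complex_of_real S *v v = z *s v"
    unfolding complex_eigenvalue_def by blast
  have comp: "(\<Sum>j\<in>UNIV. complex_of_real (S $ i $ j) * v $ j) = z * v $ i" for i
    using arg_cong[OF v(2), of "\<lambda>x. x $ i"] by (simp add: matrix_vector_mult_def map_matrix_def)
  define x where "x = (\<chi> i. Re (v $ i))"
  define y where "y = (\<chi> i. Im (v $ i))"
  have "x \<noteq> 0 \<or> y \<noteq> 0" using v(1) by (auto simp: x_def y_def vec_eq_iff complex_eq_iff)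
  moreover have "S *v x = Re z *\<^sub>R x - Im z *\<^sub>R y"
    using arg_cong[OF comp, of Re] by (simp add: vec_eq_iff x_def y_def matrix_vector_mult_def)
  moreover have "S *v y = Im z *\<^sub>R x + Re z *\<^sub>R y"
    using arg_cong[OF comp, of Im] by (simp add: vec_eq_iff x_def y_def matrix_vector_mult_def algebra_simps)
  ultimately show "\<exists>x y. (x \<noteq> 0 \<or> y \<noteq> 0) \<and>
     S *v x = Re z *\<^sub>R x - Im z *\<^sub>R y \<and> S *v y = Im z *\<^sub>R x + Re z *\<^sub>R y" by blast
next
  assume "\<exists>x y. (x \<noteq> 0 \<or> y \<noteq> 0) \<and>
     S *v x = Re z *\<^sub>R x - Im z *\<^sub>R y \<and> S *v y = Im z *\<^sub>R x + Re z *\<^sub>R y"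
  then obtain x y where xy: "x \<noteq> 0 \<or> y \<noteq> 0"
    "S *v x = Re z *\<^sub>R x - Im z *\<^sub>R y" "S *v y = Im z *\<^sub>R x + Re z *\<^sub>R y" by blast
  define v where "v = (\<chi> i. Complex (x $ i) (y $ i))"
  have "v \<noteq> 0" using xy(1) by (auto simp: v_def vec_eq_iff complex_eq_iff)
  moreover have "map_matrix complex_of_real S *v v = z *s v"
    using arg_cong[OF xy(2), of "\<lambda>w. w $ i" for i] arg_cong[OF xy(3), of "\<lambda>w. w $ i" for i]
    by (simp add: vec_eq_iff v_def complex_eq_iff matrix_vector_mult_def map_matrix_def algebra_simps)
  ultimately show "complex_eigenvalue S z" unfolding complex_eigenvalue_def by blast
qed

section \<open>Block components of vectors\<close>

definition block :: "real ^ ('k \<times> 'n) \<Rightarrow> 'k :: finite \<Rightarrow> real ^ 'n" where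
  "block x i = (\<chi> r. x $ (i, r))"

lemma block_block_mat_mult:
  "block (block_mat F *v x) i = (\<Sum>j\<in>UNIV. F i j *v block x j)"
proof -
  have "(block_mat F *v x) $ (i, r) = (\<Sum>j\<in>UNIV. F i j *v block x j) $ r" for r
    by (simp add: matrix_vector_mult_def block_mat_def block_def sum.cartesian_product case_prod_unfold)
  then show ?thesis by (simp add: block_def vec_eq_iff)
qed

lemma block_add: "block (x + y) i = block x i + block y i"
  and block_scaleR: "block (r *\<^sub>R x) i = r *\<^sub>R block x i"
  by (simp_all add: block_def vec_eq_iff)

lemma block_A_bar:
  "block (A_bar A *v x) i = (if i = last_index then A *v block x last_index else 0)"
proof -
  have "block (A_bar A *v x) i
      = (\<Sum>j\<in>UNIV. if j = last_index then (if i = last_index then A *v block x j else 0) else 0)"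
    unfolding A_bar_def block_block_mat_mult by (intro sum.cong) auto
  then show ?thesis by simp
qed

lemma block_Lam:
  "block (Lam \<tau> *v x) i = (if i = last_index then 0
     else (\<Sum>j\<in>UNIV. (\<tau> * deriv (lagrange \<tau> j) (node \<tau> i)) *\<^sub>R block x j))"
  unfolding Lam_def block_block_mat_mult by (simp flip: scaleR_matrix_vector_assoc)

lemma transpose_M_last_mult:
  fixes x :: "real ^ ('k :: {finite, linorder} \<times> 'n :: finite)"
  shows "transpose M_last *v x = block x last_index"
proof -
  have "(transpose M_last *v x) $ r = x $ (last_index, r)" for r
  proof -
    have "(transpose M_last *v x) $ r
        = (\<Sum>j\<in>UNIV. \<Sum>q\<in>UNIV. (if j = last_index then mat 1 else 0) $ q $ r * x $ (j, q))"
      by (simp add: matrix_vector_mult_def transpose_def M_last_def block_col_def sum.cartesian_product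
          case_prod_unfold del: transpose_matrix_vector)
    also have "\<dots> = (\<Sum>j\<in>UNIV. if j = last_index then x $ (j, r) else 0)"
    proof -
      have "(\<Sum>q\<in>UNIV. mat 1 $ q $ r * x $ (j, q)) = x $ (j, r)" for j
        by (simp add: mat_def if_distrib[of "\<lambda>a. a * _"] cong: if_cong)
      then show ?thesis by (intro sum.cong) auto
    qed
    finally show ?thesis by simp
  qed
  then show ?thesis by (simp add: vec_eq_iff block_def del: transpose_matrix_vector)
qed

lemma norm_M_last_mult: "norm (M_last *v y :: real ^ ('k :: {finite, linorder} \<times> 'n :: finite)) = norm y"
proof -
  let ?z = "M_last *v y :: real ^ ('k \<times> 'n)"
  have "block ?z last_index = y"
    by (simp add: vec_eq_iff block_def matrix_vector_mult_def M_last_def block_col_def mat_def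
        if_distrib[of "\<lambda>a. a * _"] cong: if_cong)
  then have "y \<bullet> (transpose M_last *v ?z) = y \<bullet> y" by (simp only: transpose_M_last_mult)
  then show ?thesis by (simp only: inner_transpose_mult norm_eq_sqrt_inner)
qed

text \<open>In the bound on \<open>\<alpha>\<close> the number of blocks of \<open>B_cal B\<close> is not tied to the other matrices by their types;
  the norm does not depend on it.\<close>

lemma norm_B_cal_mult: "norm ((B_cal B ** C) *v x) = norm ((B ** C) *v x)"
  unfolding B_cal_def matrix_mul_assoc[symmetric]
  by (simp only: norm_M_last_mult flip: matrix_vector_mul_assoc)

lemma spectral_norm_B_cal: "spectral_norm (B_cal B ** C) = spectral_norm (B ** C)"
  by (simp only: spectral_norm_def onorm_def norm_B_cal_mult)

lemma Q_tilde_quadratic: "x \<bullet> (Q_tilde Q *v x) = block x last_index \<bullet> (Q *v block x last_index)"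
proof -
  have "x \<bullet> (Q_tilde Q *v x) = x \<bullet> (transpose (transpose M_last) *v (Q *v (transpose M_last *v x)))"
    unfolding Q_tilde_def transpose_transpose by (simp only: matrix_vector_mul_assoc matrix_mul_assoc)
  then show ?thesis unfolding inner_transpose_mult transpose_M_last_mult .
qed

lemma node_scale: "node \<tau> i = \<tau> * node 1 i"
  by (simp add: node_def)

text \<open>Nodes and argument both scale with \<tau>, which cancels in every quotient. This is what
  allows the delay to vary along the path through a scalar factor alone.\<close>

lemma lagrange_scale: "\<tau> \<noteq> 0 \<Longrightarrow> lagrange \<tau> j (\<tau> * x) = lagrange 1 j x"
  unfolding lagrange_def node_scale[of \<tau>] by (simp flip: right_diff_distrib)

lemma deriv_lagrange_scale:
  assumes "\<tau> \<noteq> 0"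
  shows "\<tau> * deriv (lagrange \<tau> j) (node \<tau> i) = deriv (lagrange 1 j) (node 1 i)"
proof -
  have "((\<lambda>x. lagrange \<tau> j (\<tau> * x)) has_real_derivative deriv (lagrange \<tau> j) (\<tau> * node 1 i) * \<tau>) (at (node 1 i))"
    by (rule DERIV_chain2[of "lagrange \<tau> j"])
      (auto intro!: derivative_eq_intros field_differentiable_derivI lagrange_field_differentiable)
  then show ?thesis unfolding lagrange_scale[OF assms] node_scale[of \<tau>]
    by (metis DERIV_imp_deriv mult.commute)
qed

lemma Lam_eq: "\<tau> \<noteq> 0 \<Longrightarrow> Lam \<tau> = Lam 1"
  unfolding Lam_def by (simp add: deriv_lagrange_scale cong: if_cong)

lemma N_d_eq:
  assumes "\<tau> \<noteq> 0"
  shows "N_d \<tau> c = N_d 1 c"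
proof -
  have "- c * \<tau> = \<tau> * (- c)" by simp
  then show ?thesis unfolding N_d_def by (simp only: lagrange_scale[OF assms] mult_1_right)
qed

lemma A_cl_eq:
  "A_cl A B p X U K \<tau> c = (1 / \<tau>) *\<^sub>R Lam \<tau> + A_bar A
     - B_cal B ** ((K * I_d p X U) ** transpose (N_d \<tau> c) + (K * I_o p X U) ** transpose N_o)"
  unfolding A_cl_def A_tilde_def by (simp add: matrix_add_ldistrib matrix_mul_assoc)

text \<open>Add the inequality at x and at y: each of the two mixed products of x and y through
  \<open>P\<close> then occurs once with factor \<open>\<eta>\<close> and once with
  \<open>- \<eta>\<close>, leaving only q x + q y \<le> 0.\<close>

lemma lyapunov_imaginary_eigenvalue:
  fixes S P :: "real ^ 'n ^ 'n"
  assumes nonneg: "\<And>x. 0 \<le> q x"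
    and le: "\<And>x. (S *v x) \<bullet> (P *v x) + x \<bullet> (P *v (S *v x)) + q x \<le> 0"
    and xy: "S *v x = - (\<eta> *\<^sub>R y)" "S *v y = \<eta> *\<^sub>R x"
  shows "q x = 0" "q y = 0"
proof -
  have "q x + q y \<le> 0"
    using le[of x] le[of y]
    by (simp add: xy matrix_vector_mult_scaleR vec.neg algebra_simps)
  with nonneg[of x] nonneg[of y] show "q x = 0" "q y = 0" by linarith+
qed

text \<open>An eigenvector on the imaginary axis is invisible to the state and input costs. Detectability then
  kills its last block, and collocation with zero boundary value kills the rest.\<close>

lemma closed_loop_imaginary_eigenvalue:
  fixes A Q :: "real ^ 'n ^ 'n" and C :: "real ^ ('k :: {finite, linorder} \<times> 'n) ^ 'm"
    and P :: "real ^ ('k \<times> 'n) ^ ('k \<times> 'n)"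
  assumes N: "CARD('k) \<ge> 2" and \<tau>: "\<tau> > 0" and w: "w > 0"
    and Q: "psd Q" and R: "posdef R" and detectable: "detectable A (msqrt Q)"
    and S: "S = w *\<^sub>R Lam \<tau> + A_bar A - B_cal B ** C"
    and le: "\<And>x. (S *v x) \<bullet> (P *v x) + x \<bullet> (P *v (S *v x))
        + (x \<bullet> (Q_tilde Q *v x) + (C *v x) \<bullet> (R *v (C *v x))) \<le> 0"
    and z: "Re z = 0"
  shows "\<not> complex_eigenvalue S z"
proof
  assume "complex_eigenvalue S z"
  then obtain x y where nz: "x \<noteq> 0 \<or> y \<noteq> 0"
    and xy: "S *v x = - (Im z *\<^sub>R y)" "S *v y = Im z *\<^sub>R x"
    unfolding complex_eigenvalue_iff_real_pair z by auto
  define q where "q x = x \<bullet> (Q_tilde Q *v x) + (C *v x) \<bullet> (R *v (C *v x))" for x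
  have Rn: "0 \<le> v \<bullet> (R *v v)" for v using R by (cases "v = 0") (auto simp: posdef_def less_imp_le)
  have Qn: "0 \<le> v \<bullet> (Q *v v)" for v using Q by (simp add: psd_def)
  have q_nonneg: "0 \<le> q v" for v by (simp add: q_def Q_tilde_quadratic Rn Qn)
  have q0: "q x = 0" "q y = 0"
    using lyapunov_imaginary_eigenvalue[OF q_nonneg le[folded q_def] xy] by auto
  have C0: "C *v v = 0" and Q0: "msqrt Q *v block v last_index = 0" if "q v = 0" for v
  proof -
    from that Rn[of "C *v v"] Qn[of "block v last_index"]
    have "(C *v v) \<bullet> (R *v (C *v v)) = 0" "block v last_index \<bullet> (Q *v block v last_index) = 0"
      unfolding q_def Q_tilde_quadratic by linarith+
    then show "C *v v = 0" "msqrt Q *v block v last_index = 0"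
      using R msqrt_norm_square[OF Q, of "block v last_index"] by (auto simp: posdef_def less_le)
  qed
  \<comment> \<open>With zero input the feedback disappears, so on this eigenvector the closed loop
    acts as collocation plus \<open>A\<close> on the last block.\<close>
  have S_mult: "S *v v = w *\<^sub>R (Lam \<tau> *v v) + A_bar A *v v" if "q v = 0" for v
    using C0[OF that]
    by (simp add: S matrix_vector_mult_diff_rdistrib matrix_vector_mult_add_rdistrib
        scaleR_matrix_vector_assoc flip: matrix_vector_mul_assoc)
  have block_S: "block (S *v v) i = (if i = last_index then A *v block v last_index
      else w *\<^sub>R (\<Sum>j\<in>UNIV. (\<tau> * deriv (lagrange \<tau> j) (node \<tau> i)) *\<^sub>R block v j))" if "q v = 0" for v i
    unfolding S_mult[OF that] block_add block_scaleR block_A_bar block_Lam by simp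
  define xN where "xN = block x last_index"
  define yN where "yN = block y last_index"
  have AN: "A *v xN = - (Im z *\<^sub>R yN)" "A *v yN = Im z *\<^sub>R xN"
    using block_S[OF q0(1), of last_index] block_S[OF q0(2), of last_index]
    by (simp_all add: xy xN_def yN_def block_scaleR block_def vec_eq_iff)
  have last0: "xN = 0 \<and> yN = 0"
  proof (rule ccontr)
    assume nz: "\<not> (xN = 0 \<and> yN = 0)"
    from detectable obtain L where L: "hurwitz (A - L ** msqrt Q)" unfolding detectable_def by blast
    \<comment> \<open>The observer gain acts only through \<open>msqrt Q\<close>, which annihilates
      the last block, so an imaginary eigenvalue of \<open>A\<close> survives in a Hurwitz
      matrix.\<close>
    have "(A - L ** msqrt Q) *v xN = Re z *\<^sub>R xN - Im z *\<^sub>R yN"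
      "(A - L ** msqrt Q) *v yN = Im z *\<^sub>R xN + Re z *\<^sub>R yN"
      using Q0[OF q0(1)] Q0[OF q0(2)] AN z
      by (simp_all add: xN_def yN_def matrix_vector_mult_diff_rdistrib flip: matrix_vector_mul_assoc)
    with nz have "complex_eigenvalue (A - L ** msqrt Q) z"
      unfolding complex_eigenvalue_iff_real_pair by blast
    with L z show False by (auto simp: hurwitz_def)
  qed
  have "x $ (i, r) = 0 \<and> y $ (i, r) = 0" for i r
  proof -
    \<comment> \<open>The blocks of \<open>Lam\<close> are multiples of the identity, so the
      equations decouple into one scalar collocation problem per state coordinate r. The factor
      \<open>w\<close> moves into the eigenvalue, which stays imaginary.\<close>
    define u where "u j = Complex (x $ (j, r)) (y $ (j, r))" for j
    have "u i = 0"
    proof (rule chebyshev_collocation_kernel[OF N \<tau>])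
      show "Re (Complex 0 (Im z / w)) = 0" by simp
      show "u last_index = 0"
        using last0 by (auto simp: u_def xN_def yN_def block_def vec_eq_iff complex_eq_iff)
      fix i :: 'k assume i: "i \<noteq> last_index"
      have "w * (\<Sum>j\<in>UNIV. (\<tau> * deriv (lagrange \<tau> j) (node \<tau> i)) * x $ (j, r)) = - (Im z * y $ (i, r))"
        using arg_cong[OF block_S[OF q0(1), of i], of "\<lambda>v. v $ r"] i
        by (simp add: xy block_def)
      moreover have "w * (\<Sum>j\<in>UNIV. (\<tau> * deriv (lagrange \<tau> j) (node \<tau> i)) * y $ (j, r)) = Im z * x $ (i, r)"
        using arg_cong[OF block_S[OF q0(2), of i], of "\<lambda>v. v $ r"] i
        by (simp add: xy block_def)
      ultimately show "(\<Sum>j\<in>UNIV. complex_of_real (\<tau> * deriv (lagrange \<tau> j) (node \<tau> i)) * u j)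
          = Complex 0 (Im z / w) * u i"
        using w by (simp add: u_def complex_eq_iff field_simps)
    qed
    then show ?thesis by (simp add: u_def complex_eq_iff)
  qed
  with nz show False by (auto simp: vec_eq_iff)
qed

theorem theorem2:
  fixes A Q :: "real ^ 'n ^ 'n"
    and B :: "real ^ 'm ^ 'n"
    and R :: "real ^ 'm ^ 'm"
    and p :: nat
    and X :: "nat \<Rightarrow> 'n set"
    and U :: "nat \<Rightarrow> 'm set"
    and Ks K \<Delta>K \<Delta>K\<^sub>d \<Delta>K\<^sub>o :: "real ^ 'n ^ 'm"
    and \<tau>s cs \<omega>s \<omega> \<Delta>\<omega> \<zeta>1 \<zeta>2 \<alpha> :: real
    and Acls Ps P \<Delta>P \<Lambda> A1 \<phi>0 \<phi>1 \<psi>0 :: "real ^ ('k :: {finite, linorder} \<times> 'n) ^ ('k \<times> 'n)"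
    and Cs \<Delta>C :: "real ^ ('k \<times> 'n) ^ 'm"
  assumes N: "CARD('k) \<ge> 2"
    and Q: "psd Q" and R: "posdef R"
    and stabilizable: "stabilizable A B"
    and detectable: "detectable A (msqrt Q)"
    and groups: "is_grouping p X" "is_grouping p U"
    and stabilizing: "(Ks, \<tau>s, cs) \<in> stabilizing_tuples TYPE('k) A B p X U"
    and \<omega>s: "\<omega>s = 1 / \<tau>s"
    and Acls: "Acls = A_cl A B p X U Ks \<tau>s cs"
    and \<Lambda>: "\<Lambda> = Lam \<tau>s"
    and Cs: "Cs = (Ks * I_d p X U) ** transpose (N_d \<tau>s cs) + (Ks * I_o p X U) ** transpose N_o"
    and Ps: "transpose Acls ** Ps + Ps ** Acls = - (Q_tilde Q + transpose Cs ** R ** Cs)"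
    and \<Delta>P_sym: "transpose \<Delta>P = \<Delta>P"
    and K: "K = Ks + \<Delta>K" and \<omega>: "\<omega> = \<omega>s + \<Delta>\<omega>" "\<omega> > 0" and P: "P = Ps + \<Delta>P"
    and \<Delta>K\<^sub>d: "\<Delta>K\<^sub>d = \<Delta>K * I_d p X U" and \<Delta>K\<^sub>o: "\<Delta>K\<^sub>o = \<Delta>K * I_o p X U"
    and \<Delta>C: "\<Delta>C = \<Delta>K\<^sub>d ** transpose (N_d \<tau>s cs) + \<Delta>K\<^sub>o ** transpose N_o"
    and A1: "A1 = - (B_cal B ** \<Delta>C) + \<Delta>\<omega> *\<^sub>R \<Lambda>"
    and \<phi>0: "\<phi>0 = transpose Acls ** P + P ** Acls"
    and \<phi>1: "\<phi>1 = transpose A1 ** Ps + Ps ** A1"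
    and \<psi>0: "\<psi>0 = Q_tilde Q + transpose Cs ** R ** Cs
                   + transpose \<Delta>C ** R ** Cs + transpose Cs ** R ** \<Delta>C"
    and lmi: "psd (- (\<phi>0 + \<phi>1 + \<psi>0 + \<alpha> *\<^sub>R mat 1))"
    and bounds: "\<bar>\<Delta>\<omega>\<bar> \<le> \<zeta>1" "spectral_norm \<Delta>P \<le> \<zeta>2"
    and \<alpha>: "\<alpha> \<ge> 2 * \<zeta>1 * spectral_norm (transpose \<Lambda> ** \<Delta>P)
                + 2 * \<zeta>2 * spectral_norm (B_cal B ** \<Delta>C)
                + (spectral_norm (msqrt R ** \<Delta>C))\<^sup>2"
  shows "(K, 1 / \<omega>, cs) \<in> stabilizing_tuples TYPE('k) A B p X U"
proof -
  from stabilizing have \<tau>s: "\<tau>s > 0" and cs: "0 \<le> cs" "cs \<le> 1"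
    and start: "hurwitz Acls" by (auto simp: stabilizing_tuples_def Acls)
  have \<omega>s_pos: "\<omega>s > 0" using \<tau>s by (simp add: \<omega>s)
  have R_psd: "psd R" using R unfolding psd_def posdef_def by (metis inner_zero_left less_imp_le order_refl)
  have \<zeta>: "0 \<le> \<zeta>1" "0 \<le> \<zeta>2" using bounds spectral_norm_nonneg[of \<Delta>P] by linarith+
  \<comment> \<open>The sign matters at intermediate t, where the bound on the Lyapunov expression
    is - t (1 - t) \<open>\<alpha>\<close> times the squared norm.\<close>
  have \<alpha>_nonneg: "0 \<le> \<alpha>"
    using \<zeta> \<alpha> by (smt (verit) mult_nonneg_nonneg spectral_norm_nonneg zero_le_power2)
  have Acls_eq: "Acls = \<omega>s *\<^sub>R \<Lambda> + A_bar A - B_cal B ** Cs"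
    unfolding Acls A_cl_eq \<Lambda> \<omega>s Cs ..
  define S where "S t = Acls + t *\<^sub>R A1" for t
  define C where "C t = Cs + t *\<^sub>R \<Delta>C" for t
  have S_eq: "S t = (\<omega>s + t * \<Delta>\<omega>) *\<^sub>R Lam \<tau>s + A_bar A - B_cal B ** C t" for t
    unfolding S_def Acls_eq A1 C_def \<Lambda>[symmetric]
    by (simp add: matrix_add_ldistrib scaleR_right_diff_distrib scaleR_add_left scaleR_add_right
        matrix_scalar_ac algebra_simps flip: scalar_matrix_assoc)
  have lyap: "(S t *v x) \<bullet> ((Ps + t *\<^sub>R \<Delta>P) *v x) + x \<bullet> ((Ps + t *\<^sub>R \<Delta>P) *v (S t *v x))
        + (x \<bullet> (Q_tilde Q *v x) + (C t *v x) \<bullet> (R *v (C t *v x))) \<le> 0"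
    if t: "0 \<le> t" "t \<le> 1" for t x
  proof -
    define a0 where "a0 = Acls *v x"
    define a1 where "a1 = A1 *v x"
    define d where "d = \<Delta>P *v x"
    define c0 where "c0 = Cs *v x"
    define c1 where "c1 = \<Delta>C *v x"
    have d_sym: "x \<bullet> (\<Delta>P *v v) = v \<bullet> d" for v
      using inner_transpose_mult[of x \<Delta>P v] \<Delta>P_sym by (simp add: d_def inner_commute)
    have quad: "x \<bullet> ((transpose V ** W) *v x) = (V *v x) \<bullet> (W *v x)" for V W :: "real ^ ('k \<times> 'n) ^ ('k \<times> 'n)"
      by (simp only: inner_transpose_mult flip: matrix_vector_mul_assoc)
    have quadR: "x \<bullet> ((transpose V ** R ** W) *v x) = (V *v x) \<bullet> (R *v (W *v x))" for V W :: "real ^ ('k \<times> 'n) ^ 'm"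
      by (simp only: inner_transpose_mult flip: matrix_vector_mul_assoc)
    have base: "a0 \<bullet> (Ps *v x) + x \<bullet> (Ps *v a0) + x \<bullet> (Q_tilde Q *v x) + c0 \<bullet> (R *v c0) = 0"
    proof -
      have "x \<bullet> ((transpose Acls ** Ps + Ps ** Acls) *v x) = - (x \<bullet> ((Q_tilde Q + transpose Cs ** R ** Cs) *v x))"
        unfolding Ps matrix_vector_mult_minus_left inner_minus_right ..
      then show ?thesis
        unfolding matrix_vector_mult_add_rdistrib inner_add_right quad quadR a0_def c0_def
        by (simp flip: matrix_vector_mul_assoc)
    qed
    define L where "L = 2 * (a0 \<bullet> d) + a1 \<bullet> (Ps *v x) + x \<bullet> (Ps *v a1) + c1 \<bullet> (R *v c0) + c0 \<bullet> (R *v c1)"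
    have L: "L \<le> - \<alpha> * (x \<bullet> x)"
    proof -
      have "0 \<le> x \<bullet> ((- (\<phi>0 + \<phi>1 + \<psi>0 + \<alpha> *\<^sub>R mat 1)) *v x)" using lmi by (simp only: psd_def)
      then have "x \<bullet> ((\<phi>0 + \<phi>1 + \<psi>0 + \<alpha> *\<^sub>R mat 1) *v x) \<le> 0"
        unfolding matrix_vector_mult_minus_left inner_minus_right by simp
      then have "a0 \<bullet> (Ps *v x + d) + x \<bullet> (Ps *v a0 + \<Delta>P *v a0) + (a1 \<bullet> (Ps *v x) + x \<bullet> (Ps *v a1))
          + (x \<bullet> (Q_tilde Q *v x) + c0 \<bullet> (R *v c0) + c1 \<bullet> (R *v c0) + c0 \<bullet> (R *v c1)) + \<alpha> * (x \<bullet> x) \<le> 0"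
        unfolding \<phi>0 \<phi>1 \<psi>0 P matrix_vector_mult_add_rdistrib inner_add_right quad quadR
          a0_def a1_def c0_def c1_def d_def
        by (simp add: matrix_vector_mult_add_rdistrib inner_add_right flip: matrix_vector_mul_assoc scaleR_matrix_vector_assoc)
      then show ?thesis using base d_sym[of a0] unfolding L_def
        by (simp add: inner_add_right)
    qed
    \<comment> \<open>The part of second order. Its cross term splits by \<open>A1\<close> into a
      frequency part and a gain part; with the input cost these three match the three summands
      bounding \<open>\<alpha>\<close>.\<close>
    define G where "G = 2 * (a1 \<bullet> d) + c1 \<bullet> (R *v c1)"
    have G: "G \<le> \<alpha> * (x \<bullet> x)"
    proof -
      have xx: "norm x * norm x = x \<bullet> x" by (simp add: power2_norm_eq_inner flip: power2_eq_square)
      have "a1 \<bullet> d = - (((B_cal B ** \<Delta>C) *v x) \<bullet> d) + \<Delta>\<omega> * ((\<Lambda> *v x) \<bullet> d)"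
        unfolding a1_def A1 matrix_vector_mult_add_rdistrib matrix_vector_mult_minus_left
          scaleR_matrix_vector_assoc[symmetric] inner_add_left inner_minus_left inner_scaleR_left ..
      also have "\<dots> \<le> \<bar>((B_cal B ** \<Delta>C) *v x) \<bullet> d\<bar> + \<bar>\<Delta>\<omega>\<bar> * \<bar>(\<Lambda> *v x) \<bullet> d\<bar>"
        by (simp flip: abs_mult)
      also have "\<bar>((B_cal B ** \<Delta>C) *v x) \<bullet> d\<bar> \<le> (spectral_norm (B ** \<Delta>C) * norm x) * (\<zeta>2 * norm x)"
      proof -
        have "norm d \<le> \<zeta>2 * norm x"
          unfolding d_def using norm_mult_le_spectral_norm[of \<Delta>P x] bounds(2)
          by (meson mult_right_mono norm_ge_zero order_trans)
        then show ?thesis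
          using norm_mult_le_spectral_norm[of "B ** \<Delta>C" x]
          by (intro order_trans[OF Cauchy_Schwarz_ineq2] mult_mono) (auto simp: norm_B_cal_mult spectral_norm_nonneg)
      qed
      also have "\<bar>\<Delta>\<omega>\<bar> * \<bar>(\<Lambda> *v x) \<bullet> d\<bar> \<le> \<zeta>1 * (norm x * (spectral_norm (transpose \<Lambda> ** \<Delta>P) * norm x))"
      proof -
        have "(\<Lambda> *v x) \<bullet> d = x \<bullet> ((transpose \<Lambda> ** \<Delta>P) *v x)"
          unfolding d_def by (simp only: quad)
        then have "\<bar>(\<Lambda> *v x) \<bullet> d\<bar> \<le> norm x * (spectral_norm (transpose \<Lambda> ** \<Delta>P) * norm x)"
          by (simp only: order_trans[OF Cauchy_Schwarz_ineq2 mult_left_mono[OF norm_mult_le_spectral_norm norm_ge_zero]])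
        then show ?thesis using bounds(1) \<zeta> by (intro mult_mono) auto
      qed
      finally have "2 * (a1 \<bullet> d) \<le> 2 * ((spectral_norm (B ** \<Delta>C) * norm x) * (\<zeta>2 * norm x)
          + \<zeta>1 * (norm x * (spectral_norm (transpose \<Lambda> ** \<Delta>P) * norm x)))"
        by simp
      also have "\<dots> = (2 * \<zeta>1 * spectral_norm (transpose \<Lambda> ** \<Delta>P)
          + 2 * \<zeta>2 * spectral_norm (B ** \<Delta>C)) * (x \<bullet> x)"
        unfolding xx[symmetric] by (simp add: algebra_simps)
      finally have "2 * (a1 \<bullet> d) \<le> (2 * \<zeta>1 * spectral_norm (transpose \<Lambda> ** \<Delta>P)
          + 2 * \<zeta>2 * spectral_norm (B ** \<Delta>C)) * (x \<bullet> x)" .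
      moreover have "c1 \<bullet> (R *v c1) \<le> (spectral_norm (msqrt R ** \<Delta>C))\<^sup>2 * (x \<bullet> x)"
      proof -
        have "c1 \<bullet> (R *v c1) = (norm ((msqrt R ** \<Delta>C) *v x))\<^sup>2"
          using msqrt_norm_square[OF R_psd, of c1] by (simp add: c1_def matrix_vector_mul_assoc)
        also have "\<dots> \<le> (spectral_norm (msqrt R ** \<Delta>C) * norm x)\<^sup>2"
          by (intro power_mono norm_mult_le_spectral_norm) auto
        finally show ?thesis by (simp add: power_mult_distrib power2_norm_eq_inner)
      qed
      ultimately have "G \<le> (2 * \<zeta>1 * spectral_norm (transpose \<Lambda> ** \<Delta>P)
                + 2 * \<zeta>2 * spectral_norm (B ** \<Delta>C)
                + (spectral_norm (msqrt R ** \<Delta>C))\<^sup>2) * (x \<bullet> x)"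
        unfolding G_def by (simp add: distrib_right)
      also have "\<dots> \<le> \<alpha> * (x \<bullet> x)" using \<alpha> by (intro mult_right_mono) (auto simp: spectral_norm_B_cal)
      finally show ?thesis .
    qed
    have S_x: "S t *v x = a0 + t *\<^sub>R a1" and C_x: "C t *v x = c0 + t *\<^sub>R c1"
      and P_v: "(Ps + t *\<^sub>R \<Delta>P) *v v = Ps *v v + t *\<^sub>R (\<Delta>P *v v)" for v
      by (simp_all add: S_def C_def a0_def a1_def c0_def c1_def matrix_vector_mult_add_rdistrib
          flip: scaleR_matrix_vector_assoc)
    \<comment> \<open>There is no cubic term, as each summand has at most two factors depending on
      t; the constant term is zero by \<open>base\<close>.\<close>
    have "(S t *v x) \<bullet> ((Ps + t *\<^sub>R \<Delta>P) *v x) + x \<bullet> ((Ps + t *\<^sub>R \<Delta>P) *v (S t *v x))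
        + (x \<bullet> (Q_tilde Q *v x) + (C t *v x) \<bullet> (R *v (C t *v x))) = t * L + t\<^sup>2 * G"
      unfolding S_x C_x P_v L_def G_def d_def[symmetric] inner_add_right inner_scaleR_right d_sym
      using base
      by (simp add: matrix_vector_right_distrib matrix_vector_mult_scaleR inner_add_left inner_add_right
          inner_commute[of a0 d] inner_commute[of a1 d] power2_eq_square algebra_simps)
    also have "\<dots> \<le> t * (- \<alpha> * (x \<bullet> x)) + t\<^sup>2 * (\<alpha> * (x \<bullet> x))"
      using L G t by (intro add_mono mult_left_mono) auto
    also have "\<dots> = - (t * (1 - t) * (\<alpha> * (x \<bullet> x)))" by (simp add: power2_eq_square algebra_simps)
    also have "\<dots> \<le> 0" using t \<alpha>_nonneg by simp
    finally show ?thesis .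
  qed
  have "hurwitz (S 1)"
  proof (rule hurwitz_path)
    show "continuous_on {0..1} S" unfolding S_def by (intro continuous_intros)
    show "hurwitz (S 0)" using start by (simp add: S_def)
    fix t :: real and z assume t: "0 \<le> t" "t \<le> 1" and z: "Re z = 0"
    \<comment> \<open>A convex combination of two positive frequencies, so the delay stays positive
      and finite along the path.\<close>
    have "\<omega>s + t * \<Delta>\<omega> = (1 - t) * \<omega>s + t * \<omega>" unfolding \<omega>(1) by (simp add: algebra_simps)
    also have "\<dots> > 0"
      using t \<omega>s_pos \<omega>(2) by (cases "t = 0") (auto intro!: add_nonneg_pos)
    finally have pos: "0 < \<omega>s + t * \<Delta>\<omega>" .
    show "\<not> complex_eigenvalue (S t) z"
      by (rule closed_loop_imaginary_eigenvalue[OF N \<tau>s pos Q R detectable S_eq lyap[OF t] z])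
  qed
  moreover have "S 1 = A_cl A B p X U K (1 / \<omega>) cs"
  proof -
    \<comment> \<open>The path was written with the matrices of the old delay; scale invariance
      identifies its end with the closed loop at the new delay.\<close>
    have "Lam (1 / \<omega>) = (Lam \<tau>s :: real ^ ('k \<times> 'n) ^ ('k \<times> 'n))"
      "N_d (1 / \<omega>) cs = (N_d \<tau>s cs :: real ^ 'n ^ ('k \<times> 'n))"
      using \<omega>(2) \<tau>s by (simp_all add: Lam_eq[of "1 / \<omega>"] Lam_eq[of \<tau>s] N_d_eq[of "1 / \<omega>"] N_d_eq[of \<tau>s])
    then show ?thesis
      unfolding S_eq A_cl_eq C_def Cs \<Delta>C \<Delta>K\<^sub>d \<Delta>K\<^sub>o K using \<omega>(1)
      by (simp add: distrib_right matrix_mult_add_left add_ac)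
  qed
  ultimately show ?thesis using \<omega>(2) cs by (simp add: stabilizing_tuples_def)
qed

end
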